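(* Let $\beta>0$, $p>2$ and $\omega>0$. Then any solution of the system $$\begin{cases}-u''+\omega u-|u|^{p-2}u=0\quad\text{on }\mathbb{R}\setminus\{0\},\\ u'(0^+)=u'(0^-),\\ u(0^+)-u(0^-)=\beta u'(0^+)\end{cases}$$ belonging to $H^1(\mathbb{R}^-)\oplus H^1(\mathbb{R}^+)$ and being negative on $\mathbb{R}^-$ and positive on $\mathbb{R}^+$ is of the form $$u(x)=\begin{cases}\phi_\omega(x-x_+),& x>0,\\ -\phi_\omega(x+x_-),& x<0,\end{cases}$$ where $x_\pm>0$ and $t_\pm:=\tanh\left(\frac{p-2}{2}\sqrt{\omega}\,x_\pm\right)$ solve the system $$\begin{cases}t_+(1-t_+^2)^{\frac{1}{p-2}}=t_-(1-t_-^2)^{\frac{1}{p-2}},\\ t_+^{-1}+t_-^{-1}=\beta\sqrt{\omega}.\end{cases}$$ In particular, among the solutions in $H^1(\mathbb{R}^-)\oplus H^1(\mathbb{R}^+)$ that are negative on $\mathbb{R}^-$ and positive on $\mathbb{R}^+$: (a) there are none for $\omega\le\frac{4}{\beta^2}$; (b) there is exactly one, and it is odd, for $\omega\in\left(\frac{4}{\beta^2},\frac{p}{p-2}\frac{4}{\beta^2}\right]$; (c) there are exactly one odd solution and exactly two non-odd solutions for $\omega\in\left(\frac{p}{p-2}\frac{4}{\beta^2},+\infty\right)$.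
   Context: $\mathbb{R}^-=(-\infty,0)$, $\mathbb{R}^+=(0,+\infty)$; the space $H^1(\mathbb{R}^-)\oplus H^1(\mathbb{R}^+)$ consists of functions on $\mathbb{R}\setminus\{0\}$ whose restrictions to the two half-lines are in $H^1$, and $u(0^\pm)$, $u'(0^\pm)$ denote one-sided limits at $0$. The soliton at frequency $\omega>0$ is $$\phi_\omega(x):=\left(\frac{\omega p}{2\cosh^2\left(\frac{p-2}{2}\sqrt{\omega}\,x\right)}\right)^{\frac1{p-2}},\quad x\in\mathbb{R}.$$ *)

theory Defs
  imports "HOL-Analysis.Analysis"
begin

definition test_function :: "real set \<Rightarrow> (real \<Rightarrow> real) \<Rightarrow> bool" where
  "test_function I \<psi> \<longleftrightarrow>
     (\<forall>n x. (deriv ^^ n) \<psi> field_differentiable at x) \<and>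
     (\<exists>K. compact K \<and> K \<subseteq> I \<and> (\<forall>x. x \<notin> K \<longrightarrow> \<psi> x = 0))"

definition L2_on :: "real set \<Rightarrow> (real \<Rightarrow> real) \<Rightarrow> bool" where
  "L2_on I u \<longleftrightarrow>
     set_borel_measurable lebesgue I u \<and> set_integrable lebesgue I (\<lambda>x. (u x)\<^sup>2)"

definition weak_derivative :: "real set \<Rightarrow> (real \<Rightarrow> real) \<Rightarrow> (real \<Rightarrow> real) \<Rightarrow> bool" where
  "weak_derivative I u v \<longleftrightarrow>
     (\<forall>\<psi>. test_function I \<psi> \<longrightarrow>
        (LINT x:I|lebesgue. u x * deriv \<psi> x) = - (LINT x:I|lebesgue. v x * \<psi> x))"

definition H1_on :: "real set \<Rightarrow> (real \<Rightarrow> real) \<Rightarrow> bool" where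
  "H1_on I u \<longleftrightarrow> L2_on I u \<and> (\<exists>v. L2_on I v \<and> weak_derivative I u v)"

definition soliton :: "real \<Rightarrow> real \<Rightarrow> real \<Rightarrow> real" where
  "soliton p \<omega> x =
     (\<omega> * p / (2 * (cosh ((p - 2) / 2 * sqrt \<omega> * x))\<^sup>2)) powr (1 / (p - 2))"

text \<open>Solutions are classical: the equation holds pointwise off the origin, and the one-sided
  limits at the origin are required to exist.  Only values of \<open>u\<close> off the origin matter.\<close>

definition solves_system :: "real \<Rightarrow> real \<Rightarrow> real \<Rightarrow> (real \<Rightarrow> real) \<Rightarrow> bool" where
  "solves_system \<beta> p \<omega> u \<longleftrightarrow>
     (\<forall>x. x \<noteq> 0 \<longrightarrow>
        u field_differentiable at x \<and> deriv u field_differentiable at x \<and>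
        - deriv (deriv u) x + \<omega> * u x - \<bar>u x\<bar> powr (p - 2) * u x = 0) \<and>
     (\<exists>u0p u0m du0p du0m.
        (u \<longlongrightarrow> u0p) (at_right 0) \<and> (u \<longlongrightarrow> u0m) (at_left 0) \<and>
        (deriv u \<longlongrightarrow> du0p) (at_right 0) \<and> (deriv u \<longlongrightarrow> du0m) (at_left 0) \<and>
        du0p = du0m \<and> u0p - u0m = \<beta> * du0p)"

text \<open>A function on \<open>\<real> - {0}\<close> is encoded as a function on \<open>\<real>\<close> with the dummy value
  \<open>undefined\<close> at 0, so that equality is equality on \<open>\<real> - {0}\<close> and solutions can be counted.\<close>

definition neg_pos_solutions :: "real \<Rightarrow> real \<Rightarrow> real \<Rightarrow> (real \<Rightarrow> real) set" where
  "neg_pos_solutions \<beta> p \<omega> =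
     {u \<in> extensional (- {0}).
        H1_on {..<0} u \<and> H1_on {0<..} u \<and> solves_system \<beta> p \<omega> u \<and>
        (\<forall>x<0. u x < 0) \<and> (\<forall>x>0. u x > 0)}"

definition odd_function :: "(real \<Rightarrow> real) \<Rightarrow> bool" where
  "odd_function u \<longleftrightarrow> (\<forall>x. x \<noteq> 0 \<longrightarrow> u (- x) = - u x)"

end

theory Submission
  imports Defs
begin

text \<open>
  On a half-line the equation conserves the energy \<open>(u')\<^sup>2 - \<omega> u\<^sup>2 + (2/p) \<bar>u\<bar>\<^sup>p = c\<close>, and square
  integrability forces \<open>c = 0\<close>: the derivative of \<open>u u'\<close> differs from \<open>c\<close> by at most a multiple of
  \<open>u\<^sup>2\<close>, so \<open>u u'\<close> stays within a bounded distance of \<open>c x\<close>, while the energy identity keeps it bounded.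
  At zero energy the power \<open>w = \<bar>u\<bar> powr (- (p - 2) / 2)\<close> solves the linear equation \<open>w'' = k\<^sup>2 w\<close> with
  \<open>k = (p - 2) / 2 * sqrt \<omega>\<close>, and the energy singles out the translated hyperbolic cosines, which means
  that \<open>\<bar>u\<bar>\<close> is a translated soliton (\<open>half_line_solution_is_soliton\<close>).  Hence every solution is
  made of two solitons glued at the origin.  Since \<open>\<phi>' = - sqrt \<omega> * tanh (k x) * \<phi>\<close>, the conditions at
  the origin are equivalent to the hyperbolic tangent system together with the positivity of both
  shifts (\<open>jump_conditions_iff_tanh_system\<close>); conversely, exponential decay puts every glued pair
  of solitons into \<open>H\<^sup>1\<close> of both half-lines.  This identifies the solution set
  (\<open>neg_pos_solutions_eq\<close>).
\<close>

text \<open>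
  For the count, substitute \<open>s = 1 / t\<close>.  The second equation of the system fixes the sum of the two
  unknowns \<open>s > 1\<close>, which are therefore \<open>m - d\<close> and \<open>m + d\<close> with \<open>m = \<beta> * sqrt \<omega> / 2\<close> and
  \<open>\<bar>d\<bar> < m - 1\<close>.  The first equation says that the gap \<open>L (m + d) - L (m - d)\<close> vanishes, where
  \<open>L = level (1 / (p - 2))\<close> is the logarithm of \<open>t (1 - t\<^sup>2) powr (1 / (p - 2))\<close> in terms of \<open>s\<close>.  The gap
  is an odd function of \<open>d\<close>, and for \<open>d \<ge> 0\<close> its derivative has the sign of a strictly increasing
  function.  Hence the gap is either positive for all \<open>d > 0\<close>, or first decreases and then increases
  to infinity, with exactly one positive zero; the second alternative occurs when the slope at \<open>d = 0\<close>
  is negative, that is for \<open>m\<^sup>2 > p / (p - 2)\<close>.  The split \<open>d = 0\<close>, possible when \<open>m > 1\<close>, is the odd solution, and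
  \<open>d\<close> and \<open>- d\<close> are the two mirror images of a non-odd one.
\<close>

section \<open>The soliton and its derivatives\<close>

text \<open>
  The argument of the hyperbolic functions grows at this rate; the soliton itself decays like
  \<open>exp (- sqrt \<omega> * \<bar>x\<bar>)\<close>.
\<close>

abbreviation cosh_rate :: "real \<Rightarrow> real \<Rightarrow> real" where
  "cosh_rate p \<omega> \<equiv> (p - 2) / 2 * sqrt \<omega>"

lemma one_minus_tanh_squared: "1 - (tanh x)\<^sup>2 = 1 / (cosh x)\<^sup>2" for x :: real
proof -
  have "1 - (tanh x)\<^sup>2 = ((cosh x)\<^sup>2 - (sinh x)\<^sup>2) / (cosh x)\<^sup>2"
    by (simp add: tanh_def power_divide diff_divide_distrib del: cosh_square_eq)
  then show ?thesis
    by (simp only: hyperbolic_pythagoras)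
qed

lemma one_minus_tanh_squared_pos: "0 < 1 - (tanh x)\<^sup>2" for x :: real
  by (simp add: one_minus_tanh_squared)

lemma soliton_eq_tanh:
  assumes "p > 2" "\<omega> > 0"
  shows "soliton p \<omega> x
           = (\<omega> * p / 2) powr (1 / (p - 2)) * (1 - (tanh (cosh_rate p \<omega> * x))\<^sup>2) powr (1 / (p - 2))"
proof -
  have "\<omega> * p / (2 * (cosh (cosh_rate p \<omega> * x))\<^sup>2) = (\<omega> * p / 2) * (1 - (tanh (cosh_rate p \<omega> * x))\<^sup>2)"
    by (simp add: one_minus_tanh_squared)
  then show ?thesis
    unfolding soliton_def using assms one_minus_tanh_squared_pos by (simp only: powr_mult)
qed

lemma soliton_pos: "p > 2 \<Longrightarrow> \<omega> > 0 \<Longrightarrow> 0 < soliton p \<omega> x"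
  by (simp add: soliton_def)

lemma soliton_minus [simp]: "soliton p \<omega> (- x) = soliton p \<omega> x"
  by (simp add: soliton_def)

text \<open>
  The maximum point recovers the centre of a soliton from its values; this is what separates
  different glued profiles.
\<close>

lemma soliton_strict_max:
  assumes "p > 2" "\<omega> > 0" "x \<noteq> 0"
  shows "soliton p \<omega> x < soliton p \<omega> 0"
proof -
  have "(tanh (cosh_rate p \<omega> * x))\<^sup>2 > 0"
    using assms by simp
  then have "(1 - (tanh (cosh_rate p \<omega> * x))\<^sup>2) powr (1 / (p - 2)) < 1 powr (1 / (p - 2))"
    using assms one_minus_tanh_squared_pos[of "cosh_rate p \<omega> * x"] by (intro powr_less_mono2) auto
  then show ?thesis
    using assms by (simp add: soliton_eq_tanh)
qed

text \<open>
  The nonlinearity becomes quadratic in the hyperbolic tangent, which turns the soliton equation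
  into an identity between polynomials in the tangent.
\<close>

lemma soliton_powr:
  assumes "p > 2" "\<omega> > 0"
  shows "soliton p \<omega> x powr (p - 2) = \<omega> * p / 2 * (1 - (tanh (cosh_rate p \<omega> * x))\<^sup>2)"
  using assms by (simp add: soliton_def powr_powr one_minus_tanh_squared)

abbreviation soliton_deriv :: "real \<Rightarrow> real \<Rightarrow> real \<Rightarrow> real" where
  "soliton_deriv p \<omega> x \<equiv> - (sqrt \<omega> * tanh (cosh_rate p \<omega> * x) * soliton p \<omega> x)"

lemma soliton_has_derivative:
  assumes "p > 2" "\<omega> > 0"
  shows "(soliton p \<omega> has_real_derivative soliton_deriv p \<omega> x) (at x)"
proof -
  define a k T where "a = 1 / (p - 2)" and "k = cosh_rate p \<omega>" and "T = (\<lambda>x. tanh (k * x))"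
  have pos: "0 < 1 - (T x)\<^sup>2" for x
    unfolding T_def by (rule one_minus_tanh_squared_pos)
  have ak: "2 * a * k = sqrt \<omega>"
    using assms by (simp add: a_def k_def)
  have T: "(T has_real_derivative k * (1 - (T x)\<^sup>2)) (at x)" for x
    unfolding T_def by (auto intro!: derivative_eq_intros simp: cosh_real_nonzero)
  have inner: "((\<lambda>x. 1 - (T x)\<^sup>2) has_real_derivative - (2 * T x * (k * (1 - (T x)\<^sup>2)))) (at x)"
    by (auto intro!: derivative_eq_intros T)
  have "((\<lambda>x. (1 - (T x)\<^sup>2) powr a) has_real_derivative
          a * (1 - (T x)\<^sup>2) powr (a - 1) * - (2 * T x * (k * (1 - (T x)\<^sup>2)))) (at x)"
    using DERIV_fun_powr[OF inner pos, of a] by simp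
  moreover have "a * (1 - (T x)\<^sup>2) powr (a - 1) * - (2 * T x * (k * (1 - (T x)\<^sup>2)))
      = - ((2 * a * k) * T x * (1 - (T x)\<^sup>2) powr a)"
    using pos[of x] by (simp add: powr_diff)
  ultimately have "((\<lambda>x. (1 - (T x)\<^sup>2) powr a) has_real_derivative
          - (sqrt \<omega> * T x * (1 - (T x)\<^sup>2) powr a)) (at x)"
    by (simp only: ak)
  note DERIV_cmult[OF this, of "(\<omega> * p / 2) powr a"]
  moreover have "soliton p \<omega> = (\<lambda>x. (\<omega> * p / 2) powr a * (1 - (T x)\<^sup>2) powr a)"
    unfolding T_def k_def a_def by (rule ext) (rule soliton_eq_tanh[OF assms])
  ultimately show ?thesis
    unfolding k_def T_def by (simp add: mult_ac)
qed

lemma soliton_has_second_derivative: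
  assumes "p > 2" "\<omega> > 0"
  shows "(soliton_deriv p \<omega> has_real_derivative
           \<omega> * soliton p \<omega> x - soliton p \<omega> x powr (p - 2) * soliton p \<omega> x) (at x)"
proof -
  define T where "T = tanh (cosh_rate p \<omega> * x)"
  have sq: "sqrt \<omega> * sqrt \<omega> = \<omega>"
    using assms by simp
  have "((\<lambda>x. sqrt \<omega> * tanh (cosh_rate p \<omega> * x)) has_real_derivative
         sqrt \<omega> * (cosh_rate p \<omega> * (1 - T\<^sup>2))) (at x)"
    unfolding T_def by (rule DERIV_cmult) (auto intro!: derivative_eq_intros simp: cosh_real_nonzero)
  from DERIV_minus[OF DERIV_mult[OF this soliton_has_derivative[OF assms, of x]]]
  have "((\<lambda>x. - (sqrt \<omega> * tanh (cosh_rate p \<omega> * x) * soliton p \<omega> x)) has_real_derivative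
         - ((sqrt \<omega> * (cosh_rate p \<omega> * (1 - T\<^sup>2))) * soliton p \<omega> x
            + (sqrt \<omega> * T) * - (sqrt \<omega> * T * soliton p \<omega> x))) (at x)"
    unfolding T_def by (simp add: add.commute mult.commute)
  moreover have "- ((r * (q * r * (1 - T\<^sup>2))) * v + (r * T) * - (r * T * v))
      = - ((r * r) * q * (1 - T\<^sup>2) * v) + (r * r) * T\<^sup>2 * v" for r q v :: real
    by (simp add: power2_eq_square algebra_simps)
  note this[of "sqrt \<omega>" "(p - 2) / 2" "soliton p \<omega> x"]
  moreover have "- ((sqrt \<omega> * sqrt \<omega>) * ((p - 2) / 2) * (1 - T\<^sup>2) * soliton p \<omega> x)
        + (sqrt \<omega> * sqrt \<omega>) * T\<^sup>2 * soliton p \<omega> x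
      = \<omega> * soliton p \<omega> x - soliton p \<omega> x powr (p - 2) * soliton p \<omega> x"
    unfolding soliton_powr[OF assms] sq T_def[symmetric] by (simp add: field_simps)
  ultimately show ?thesis by (simp only:)
qed

section \<open>Solutions on a half-line\<close>

lemma const_of_zero_derivative_pos:
  fixes f :: "real \<Rightarrow> real"
  assumes "\<And>x. x > 0 \<Longrightarrow> (f has_real_derivative 0) (at x)"
  obtains c where "\<And>x. x > 0 \<Longrightarrow> f x = c"
proof
  fix x :: real assume "x > 0"
  show "f x = f 1"
    by (rule DERIV_isconst3[of 0 "max x 1 + 1"]) (use assms \<open>x > 0\<close> in auto)
qed

lemma powr_extract_nonlinearity:
  fixes v p :: real
  assumes "v > 0"
  shows "v powr (p - 1) = v powr (p - 2) * v" "v powr p = v powr (p - 2) * v\<^sup>2"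
  using assms by (simp_all add: powr_diff powr_numeral field_simps power2_eq_square flip: powr_realpow)

text \<open>
  At zero energy the substitution \<open>w = u powr (- (p - 2) / 2)\<close> linearises the equation: it becomes
  \<open>w'' = k\<^sup>2 w\<close>, and the energy becomes \<open>(k w)\<^sup>2 - (w')\<^sup>2 = (p - 2)\<^sup>2 / (2 p)\<close>.  Solutions of the linear
  equation combine \<open>exp (k x)\<close> and \<open>exp (- k x)\<close>; the energy fixes the product of the two
  coefficients, and a positive product together with \<open>w > 0\<close> leaves a translated hyperbolic cosine.
\<close>

lemma zero_energy_imp_soliton:
  fixes u u' :: "real \<Rightarrow> real"
  assumes p: "p > 2" and \<omega>: "\<omega> > 0"
    and pos: "\<And>x. x > 0 \<Longrightarrow> u x > 0"
    and u: "\<And>x. x > 0 \<Longrightarrow> (u has_real_derivative u' x) (at x)"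
    and u': "\<And>x. x > 0 \<Longrightarrow> (u' has_real_derivative \<omega> * u x - u x powr (p - 1)) (at x)"
    and energy: "\<And>x. x > 0 \<Longrightarrow> (u' x)\<^sup>2 = \<omega> * (u x)\<^sup>2 - 2 / p * u x powr p"
  obtains y where "\<And>x. x > 0 \<Longrightarrow> u x = soliton p \<omega> (x - y)"
proof -
  define b k where "b = (p - 2) / 2" and "k = cosh_rate p \<omega>"
  have b: "b > 0" and k: "k > 0" and kb: "k = b * sqrt \<omega>" "k\<^sup>2 = b\<^sup>2 * \<omega>"
    using p \<omega> by (auto simp: b_def k_def power_mult_distrib power_divide)
  define w w' where "w = (\<lambda>x. u x powr (- b))"
    and "w' = (\<lambda>x. - b * u x powr (- b - 1) * u' x)"
  have wpos: "w x > 0" if "x > 0" for x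
    using pos[OF that] by (simp add: w_def)
  have w: "(w has_real_derivative w' x) (at x)" if "x > 0" for x
    unfolding w_def w'_def using DERIV_fun_powr[OF u, of x "- b"] pos[OF that] that by simp
  note up = powr_extract_nonlinearity[OF pos, where p = p]
  have w': "(w' has_real_derivative k\<^sup>2 * w x) (at x)" if x: "x > 0" for x
  proof -
    have 0: "((\<lambda>x. u x powr (- b - 1)) has_real_derivative (- b - 1) * u x powr (- b - 2) * u' x) (at x)"
      using DERIV_fun_powr[OF u, of x "- b - 1"] pos[OF x] x by (simp add: algebra_simps)
    have "(w' has_real_derivative
        - b * ((- b - 1) * u x powr (- b - 2) * u' x * u' x
               + u x powr (- b - 1) * (\<omega> * u x - u x powr (p - 1)))) (at x)"
      unfolding w'_def using DERIV_cmult[OF DERIV_mult[OF 0 u'[OF x]], of "- b"]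
      by (simp add: algebra_simps)
    moreover have "u x powr (- b - 2) = w x / (u x)\<^sup>2" "u x powr (- b - 1) = w x / u x"
      using pos[OF x] by (simp_all add: w_def powr_diff powr_numeral)
    moreover have "- b * ((- b - 1) * (w x / (u x)\<^sup>2) * u' x * u' x
               + w x / u x * (\<omega> * u x - u x powr (p - 1))) = k\<^sup>2 * w x"
    proof -
      have "- b * ((- b - 1) * (w x / (u x)\<^sup>2) * u' x * u' x
               + w x / u x * (\<omega> * u x - u x powr (p - 1)))
        = b * w x * ((b + 1) * ((u' x)\<^sup>2 / (u x)\<^sup>2) - (\<omega> - u x powr (p - 2)))"
        using pos[OF x] by (simp add: up[OF x] field_simps power2_eq_square)
      also have "(u' x)\<^sup>2 / (u x)\<^sup>2 = \<omega> - 2 / p * u x powr (p - 2)"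
        using pos[OF x] p by (simp add: energy[OF x] up[OF x] field_simps)
      also have "b * w x * ((b + 1) * (\<omega> - 2 / p * u x powr (p - 2)) - (\<omega> - u x powr (p - 2)))
         = k\<^sup>2 * w x"
        unfolding kb(2) using p by (simp add: b_def field_simps power2_eq_square)
      finally show ?thesis .
    qed
    ultimately show ?thesis by simp
  qed
  have kw: "(k * w x)\<^sup>2 - (w' x)\<^sup>2 = b\<^sup>2 * (2 / p)" if x: "x > 0" for x
  proof -
    have 1: "(w' x)\<^sup>2 = b\<^sup>2 * (w x)\<^sup>2 * ((u' x)\<^sup>2 / (u x)\<^sup>2)"
      using pos[OF x] by (simp add: w'_def w_def powr_diff power_mult_distrib power_divide)
    have 2: "(u' x)\<^sup>2 / (u x)\<^sup>2 = \<omega> - 2 / p * u x powr (p - 2)"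
      using pos[OF x] p by (simp add: energy[OF x] up[OF x] field_simps)
    have "(w x)\<^sup>2 * u x powr (p - 2) = u x powr (- b + - b + (p - 2))"
      unfolding w_def power2_eq_square powr_add ..
    also have "- b + - b + (p - 2) = 0" by (simp add: b_def)
    finally have 3: "(w x)\<^sup>2 * u x powr (p - 2) = 1"
      using pos[OF x] by simp
    have "(k * w x)\<^sup>2 - (w' x)\<^sup>2 = b\<^sup>2 * (2 / p) * ((w x)\<^sup>2 * u x powr (p - 2))"
      unfolding 1 2 power_mult_distrib kb using \<omega> by (simp add: algebra_simps)
    then show ?thesis by (simp add: 3)
  qed
  \<comment> \<open>The operator \<open>D\<^sup>2 - k\<^sup>2\<close> factors as \<open>(D - k) (D + k)\<close>, so these two expressions are
    constant; they are the coefficients of the exponentials, up to the factor \<open>2 k\<close>.\<close>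
  define P Q where "P = (\<lambda>x. (k * w x + w' x) * exp (- k * x))"
    and "Q = (\<lambda>x. (k * w x - w' x) * exp (k * x))"
  have "(P has_real_derivative 0) (at x)" if "x > 0" for x
    unfolding P_def using w[OF that] w'[OF that]
    by (auto intro!: derivative_eq_intros simp: algebra_simps power2_eq_square)
  then obtain P0 where P0: "P x = P0" if "x > 0" for x
    using const_of_zero_derivative_pos by blast
  have "(Q has_real_derivative 0) (at x)" if "x > 0" for x
    unfolding Q_def using w[OF that] w'[OF that]
    by (auto intro!: derivative_eq_intros simp: algebra_simps power2_eq_square)
  then obtain Q0 where Q0: "Q x = Q0" if "x > 0" for x
    using const_of_zero_derivative_pos by blast
  have PQ: "P0 * Q0 = b\<^sup>2 * (2 / p)"
  proof -
    have "P0 * Q0 = ((k * w 1)\<^sup>2 - (w' 1)\<^sup>2) * (exp (- k) * exp k)"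
      unfolding P0[of 1, simplified, symmetric] Q0[of 1, simplified, symmetric] P_def Q_def
      by (simp add: power2_eq_square algebra_simps)
    then show ?thesis by (simp add: kw flip: exp_add)
  qed
  have wPQ: "2 * k * w x = P0 * exp (k * x) + Q0 * exp (- k * x)" if "x > 0" for x
  proof -
    have "k * w x + w' x = P0 * exp (k * x)" "k * w x - w' x = Q0 * exp (- k * x)"
      using P0[OF that] Q0[OF that] unfolding P_def Q_def by (auto simp: exp_minus field_simps)
    then show ?thesis by simp
  qed
  have "P0 * Q0 > 0"
    using PQ b p by simp
  moreover have "P0 * exp k + Q0 * exp (- k) > 0"
    using wPQ[of 1] mult_pos_pos[OF _ wpos[of 1], of "2 * k"] k by simp
  then have "\<not> (P0 < 0 \<and> Q0 < 0)"
    by (metis add_neg_neg exp_gt_zero mult_neg_pos order.asym)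
  ultimately have "P0 > 0" "Q0 > 0"
    by (auto simp: zero_less_mult_iff)
  \<comment> \<open>The translation that makes the two exponential coefficients equal; their common
    value is then \<open>R\<close>.\<close>
  define y where "y = ln (Q0 / P0) / (2 * k)"
  define R where "R = P0 * exp (k * y)"
  have e2: "exp (k * y) * exp (k * y) = Q0 / P0"
    using k \<open>P0 > 0\<close> \<open>Q0 > 0\<close> by (simp add: y_def flip: exp_add)
  have RP: "P0 = R * exp (- k * y)" 
    by (simp add: R_def exp_minus)
  have RQ: "Q0 = R * exp (k * y)" 
    using e2 \<open>P0 > 0\<close> by (simp add: R_def field_simps)
  have R2: "R\<^sup>2 = b\<^sup>2 * (2 / p)"
    unfolding PQ[symmetric] by (subst RP, subst RQ) (simp add: power2_eq_square exp_minus)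
  have wcosh: "k * w x = R * cosh (k * (x - y))" if "x > 0" for x
    using wPQ[OF that] unfolding RP RQ
    by (simp add: cosh_field_def exp_minus exp_diff exp_add right_diff_distrib field_simps)
  have "u x = soliton p \<omega> (x - y)" if x: "x > 0" for x
  proof -
    have "(k * w x)\<^sup>2 = R\<^sup>2 * (cosh (k * (x - y)))\<^sup>2"
      using wcosh[OF x] by (simp add: power_mult_distrib)
    then have "b\<^sup>2 * (\<omega> * (w x)\<^sup>2) = b\<^sup>2 * (2 / p * (cosh (k * (x - y)))\<^sup>2)"
      unfolding R2 power_mult_distrib kb(2) by (simp only: mult.assoc)
    then have "\<omega> * (w x)\<^sup>2 = 2 / p * (cosh (k * (x - y)))\<^sup>2"
      by (rule mult_left_cancel[THEN iffD1, rotated]) (use b in simp)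
    then have "\<omega> * p / (2 * (cosh (k * (x - y)))\<^sup>2) = 1 / (w x)\<^sup>2"
      using p wpos[OF x] by (simp add: field_simps)
    also have "\<dots> = u x powr (p - 2)"
    proof -
      have "(w x)\<^sup>2 = u x powr (- (p - 2))"
        unfolding w_def power2_eq_square by (simp add: b_def flip: powr_add)
      then have "(w x)\<^sup>2 = 1 / u x powr (p - 2)"
        by (simp only: powr_minus_divide)
      then show ?thesis by simp
    qed
    finally show ?thesis
      unfolding soliton_def k_def using pos[OF x] p by (simp add: powr_powr)
  qed
  then show ?thesis by (rule that)
qed

text \<open>
  The conserved energy \<open>c\<close> must vanish.  The energy identity bounds \<open>u\<close> and \<open>u'\<close>, hence \<open>u u'\<close>.
  On the other hand \<open>(u u')' = c + 2 \<omega> u\<^sup>2 - (1 + 2 / p) u powr p\<close>, where the terms other than \<open>c\<close> are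
  at most a multiple of \<open>u\<^sup>2\<close>, since \<open>u\<close> is bounded, and have a bounded integral.  So \<open>u u'\<close> grows like \<open>c x\<close>, which is
  compatible with boundedness only for \<open>c = 0\<close>.
\<close>

lemma half_line_solution_is_soliton:
  fixes u u' :: "real \<Rightarrow> real"
  assumes p: "p > 2" and \<omega>: "\<omega> > 0"
    and pos: "\<And>x. x > 0 \<Longrightarrow> u x > 0"
    and u: "\<And>x. x > 0 \<Longrightarrow> (u has_real_derivative u' x) (at x)"
    and u': "\<And>x. x > 0 \<Longrightarrow> (u' has_real_derivative \<omega> * u x - u x powr (p - 1)) (at x)"
    and L2: "\<And>x. x \<ge> 1 \<Longrightarrow> integral {1..x} (\<lambda>t. (u t)\<^sup>2) \<le> B"
  obtains y where "\<And>x. x > 0 \<Longrightarrow> u x = soliton p \<omega> (x - y)"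
proof -
  note up = powr_extract_nonlinearity[OF pos, where p = p]
  have "((\<lambda>x. (u' x)\<^sup>2 - \<omega> * (u x)\<^sup>2 + 2 / p * u x powr p) has_real_derivative 0) (at x)"
    if x: "x > 0" for x
    using DERIV_fun_powr[OF u[OF x] pos[OF x], of p] p
    by (auto intro!: derivative_eq_intros u[OF x] u'[OF x] pos[OF x] simp: field_simps)
  then obtain c where "(u' x)\<^sup>2 - \<omega> * (u x)\<^sup>2 + 2 / p * u x powr p = c" if "x > 0" for x
    using const_of_zero_derivative_pos by blast
  then have energy: "(u' x)\<^sup>2 = c + \<omega> * (u x)\<^sup>2 - 2 / p * u x powr p" if "x > 0" for x
    using that by (smt (verit))
  \<comment> \<open>For \<open>u \<ge> 1\<close> the energy identity gives \<open>(2 / p) u powr p \<le> (\<bar>c\<bar> + \<omega>) u\<^sup>2\<close>; the summand 1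
    covers \<open>u < 1\<close>.\<close>
  define N where "N = 1 + p / 2 * (\<bar>c\<bar> + \<omega>)"
  have N: "u x powr (p - 2) \<le> N" if x: "x > 0" for x
  proof (cases "u x \<ge> 1")
    case True
    have "2 / p * u x powr p \<le> c + \<omega> * (u x)\<^sup>2"
      using energy[OF x] zero_le_power2[of "u' x"] by linarith
    also have "\<dots> \<le> (\<bar>c\<bar> + \<omega>) * (u x)\<^sup>2"
    proof -
      have "c \<le> \<bar>c\<bar> * (u x)\<^sup>2"
        using mult_left_mono[of 1 "(u x)\<^sup>2" "\<bar>c\<bar>"] True by (simp add: one_le_power)
      then show ?thesis by (simp add: algebra_simps)
    qed
    finally have "(2 / p * u x powr (p - 2)) * (u x)\<^sup>2 \<le> (\<bar>c\<bar> + \<omega>) * (u x)\<^sup>2"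
      by (simp add: up[OF x])
    then have "2 / p * u x powr (p - 2) \<le> \<bar>c\<bar> + \<omega>"
      by (rule mult_right_le_imp_le) (use pos[OF x] in simp)
    then have "u x powr (p - 2) \<le> p / 2 * (\<bar>c\<bar> + \<omega>)"
      using p by (simp add: field_simps)
    then show ?thesis by (simp add: N_def)
  next
    case False
    then have "u x powr (p - 2) \<le> 1 powr (p - 2)"
      using pos[OF x] p by (intro powr_mono2) auto
    also have "\<dots> \<le> N"
      using p \<omega> by (simp add: N_def)
    finally show ?thesis .
  qed
  have "N > 0"
    using p \<omega> by (auto simp: N_def intro!: add_pos_nonneg)
  define M where "M = N powr (1 / (p - 2))"
  have M: "u x \<le> M" if x: "x > 0" for x
  proof -
    have "u x = (u x powr (p - 2)) powr (1 / (p - 2))"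
      using p pos[OF x] by (simp add: powr_powr)
    also have "\<dots> \<le> M"
      unfolding M_def using p N[OF x] by (intro powr_mono2) auto
    finally show ?thesis .
  qed
  define F where "F = M\<^sup>2 * (\<bar>c\<bar> + \<omega> * M\<^sup>2) + 1"
  have F: "\<bar>u x * u' x\<bar> \<le> F" if x: "x > 0" for x
  proof -
    have uM: "(u x)\<^sup>2 \<le> M\<^sup>2"
      using M[OF x] pos[OF x] by (intro power_mono) auto
    have "(u' x)\<^sup>2 \<le> c + \<omega> * (u x)\<^sup>2"
      using energy[OF x] p by simp
    also have "\<dots> \<le> \<bar>c\<bar> + \<omega> * M\<^sup>2"
      using uM \<omega> by (intro add_mono) auto
    finally have "(u x)\<^sup>2 * (u' x)\<^sup>2 \<le> M\<^sup>2 * (\<bar>c\<bar> + \<omega> * M\<^sup>2)"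
      using uM by (intro mult_mono) auto
    moreover have "\<bar>u x * u' x\<bar> \<le> (u x * u' x)\<^sup>2 + 1"
    proof -
      have "0 \<le> (\<bar>u x * u' x\<bar> - 1)\<^sup>2 + \<bar>u x * u' x\<bar>"
        by simp
      then show ?thesis by (simp add: power2_diff)
    qed
    ultimately show ?thesis
      by (simp add: F_def power_mult_distrib)
  qed
  \<comment> \<open>The derivative of \<open>u u' - c x\<close>, with \<open>(u')\<^sup>2\<close> eliminated through the energy.\<close>
  define g' where "g' = (\<lambda>x. 2 * \<omega> * (u x)\<^sup>2 - (2 / p + 1) * u x powr (p - 2) * (u x)\<^sup>2)"
  have g: "((\<lambda>x. u x * u' x - c * x) has_real_derivative g' x) (at x)" if x: "x > 0" for x
  proof -
    have "((\<lambda>x. u x * u' x - c * x) has_real_derivative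
         (u' x)\<^sup>2 + u x * (\<omega> * u x - u x powr (p - 1)) - c) (at x)"
      by (auto intro!: derivative_eq_intros u[OF x] u'[OF x] simp: power2_eq_square)
    moreover have "(u' x)\<^sup>2 + u x * (\<omega> * u x - u x powr (p - 1)) - c = g' x"
      unfolding g'_def energy[OF x] up[OF x] by (simp add: algebra_simps power2_eq_square)
    ultimately show ?thesis by simp
  qed
  define C where "C = 2 * \<omega> + 2 * N"
  have C: "\<bar>g' x\<bar> \<le> C * (u x)\<^sup>2" if x: "x > 0" for x
  proof -
    have "(2 / p + 1) * u x powr (p - 2) \<le> 2 * N"
      using p N[OF x] by (intro mult_mono) auto
    moreover have "0 \<le> (2 / p + 1) * u x powr (p - 2)"
      using p by simp
    ultimately have "\<bar>2 * \<omega> - (2 / p + 1) * u x powr (p - 2)\<bar> \<le> C"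
      using \<omega> unfolding C_def by linarith
    then have "\<bar>2 * \<omega> - (2 / p + 1) * u x powr (p - 2)\<bar> * (u x)\<^sup>2 \<le> C * (u x)\<^sup>2"
      by (intro mult_right_mono) auto
    moreover have "g' x = (2 * \<omega> - (2 / p + 1) * u x powr (p - 2)) * (u x)\<^sup>2"
      by (simp add: g'_def algebra_simps)
    ultimately show ?thesis by (simp add: abs_mult)
  qed
  have linear_growth: "\<bar>c\<bar> * (x - 1) \<le> C * B + 2 * F" if x: "x \<ge> 1" for x
  proof -
    have hi: "(g' has_integral (u x * u' x - c * x) - (u 1 * u' 1 - c * 1)) {1..x}"
    proof (rule fundamental_theorem_of_calculus)
      fix t assume "t \<in> {1..x}"
      then have "((\<lambda>x. u x * u' x - c * x) has_real_derivative g' t) (at t)"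
        by (intro g) auto
      then show "((\<lambda>x. u x * u' x - c * x) has_vector_derivative g' t) (at t within {1..x})"
        by (simp add: has_real_derivative_iff_has_vector_derivative has_vector_derivative_at_within)
    qed (rule x)
    have "continuous_on {1..x} u"
      by (rule DERIV_continuous_on[of _ _ u'])
         (use u in \<open>auto intro: has_field_derivative_at_within\<close>)
    then have ui: "(\<lambda>t. C * (u t)\<^sup>2) integrable_on {1..x}"
      by (intro integrable_continuous_interval continuous_intros)
    have "norm (integral {1..x} g') \<le> integral {1..x} (\<lambda>t. C * (u t)\<^sup>2)"
      using hi ui C by (intro integral_norm_bound_integral) (auto simp: integrable_on_def)
    also have "\<dots> = C * integral {1..x} (\<lambda>t. (u t)\<^sup>2)"
      by simp
    also have "\<dots> \<le> C * B"
      using L2[OF x] \<omega> \<open>N > 0\<close> by (intro mult_left_mono) (auto simp: C_def)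
    finally have "\<bar>(u x * u' x - c * x) - (u 1 * u' 1 - c * 1)\<bar> \<le> C * B"
      using integral_unique[OF hi] by simp
    then have "\<bar>c * (x - 1)\<bar> \<le> C * B + \<bar>u x * u' x\<bar> + \<bar>u 1 * u' 1\<bar>"
      by (simp add: algebra_simps)
    then show ?thesis
      using F[of x] F[of 1] x by (simp add: abs_mult)
  qed
  have "c = 0"
  proof (rule ccontr)
    assume c: "c \<noteq> 0"
    have nonneg: "0 \<le> C * B + 2 * F"
      using linear_growth[of 1] by simp
    \<comment> \<open>A point at which linear growth has just exceeded the bound.\<close>
    define x where "x = 1 + (C * B + 2 * F + 1) / \<bar>c\<bar>"
    have "\<bar>c\<bar> * (x - 1) = C * B + 2 * F + 1"
      using c by (simp add: x_def)
    moreover have "x \<ge> 1"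
      using nonneg by (simp add: x_def)
    ultimately show False
      using linear_growth[of x] by simp
  qed
  with energy have "(u' x)\<^sup>2 = \<omega> * (u x)\<^sup>2 - 2 / p * u x powr p" if "x > 0" for x
    using that by simp
  then show ?thesis
    using zero_energy_imp_soliton[OF p \<omega> pos u u'] that by blast
qed

section \<open>Sobolev regularity of exponentially decaying functions\<close>

lemma exp_minus_abs_absolutely_integrable:
  fixes c :: real
  assumes "c > 0"
  shows "(\<lambda>x. exp (- c * \<bar>x\<bar>)) absolutely_integrable_on UNIV"
proof -
  have 1: "(\<lambda>x. exp (- c * x)) absolutely_integrable_on {0..}"
    using assms by (intro nonnegative_absolutely_integrable_1 integrable_on_exp_minus_to_infinity) auto
  then have "(\<lambda>x. exp (- c * \<bar>x\<bar>)) absolutely_integrable_on {0..}"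
    by (rule absolutely_integrable_spike[of _ _ "{}"]) auto
  moreover have "(\<lambda>x. exp (c * x)) absolutely_integrable_on {..0}"
    using has_absolute_integral_reflect_real[of "{..0::real}" "{0..}" "\<lambda>x. exp (- c * x)" "integral {0..} (\<lambda>x. exp (- c * x))"] 1
    by auto
  then have "(\<lambda>x. exp (- c * \<bar>x\<bar>)) absolutely_integrable_on {..0}"
    by (rule absolutely_integrable_spike[of _ _ "{}"]) auto
  ultimately have "(\<lambda>x. exp (- c * \<bar>x\<bar>)) absolutely_integrable_on ({0..} \<union> {..0})"
    by (rule absolutely_integrable_Un)
  moreover have "{0..} \<union> {..0} = (UNIV :: real set)"
    by auto
  ultimately show ?thesis by simp
qed

lemma L2_on_of_exponential_decay:
  fixes f :: "real \<Rightarrow> real"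
  assumes "open I" "continuous_on I f" "c > 0"
    and decay: "\<And>x. x \<in> I \<Longrightarrow> \<bar>f x\<bar> \<le> C * exp (- c * \<bar>x\<bar>)"
  shows "L2_on I f"
  unfolding L2_on_def
proof
  have I: "I \<in> sets lebesgue"
    using \<open>open I\<close> by (auto intro!: sets_completionI_sets)
  show "set_borel_measurable lebesgue I f"
    using continuous_imp_measurable_on_sets_lebesgue[OF assms(2) I] I
    by (simp add: set_borel_measurable_def borel_measurable_restrict_space_iff)
  have "(\<lambda>x. C\<^sup>2 * exp (- (2 * c) * \<bar>x\<bar>)) absolutely_integrable_on I"
    using exp_minus_abs_absolutely_integrable[of "2 * c"] \<open>c > 0\<close>
    by (intro set_integrable_mult_right set_integrable_subset[OF _ I]) auto
  then have "(\<lambda>x. C\<^sup>2 * exp (- (2 * c) * \<bar>x\<bar>)) integrable_on I"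
    by (rule set_lebesgue_integral_eq_integral)
  moreover have "norm ((f x)\<^sup>2) \<le> C\<^sup>2 * exp (- (2 * c) * \<bar>x\<bar>)" if "x \<in> I" for x
  proof -
    have "\<bar>f x\<bar>\<^sup>2 \<le> (C * exp (- c * \<bar>x\<bar>))\<^sup>2"
      using decay[OF that] by (intro power_mono) auto
    then show ?thesis
      by (simp add: power_mult_distrib flip: exp_double mult.assoc)
  qed
  ultimately show "set_integrable lebesgue I (\<lambda>x. (f x)\<^sup>2)"
    using assms(2) I
    by (intro measurable_bounded_by_integrable_imp_absolutely_integrable
          continuous_imp_measurable_on_sets_lebesgue continuous_intros) auto
qed

text \<open>
  Integration by parts on a compact interval that contains the support of the test function.  By
  continuity the test function vanishes at both endpoints, so there are no boundary terms.
\<close>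

lemma weak_derivative_of_classical:
  fixes f f' :: "real \<Rightarrow> real"
  assumes "is_interval I"
    and f: "\<And>x. x \<in> I \<Longrightarrow> (f has_real_derivative f' x) (at x)"
    and f': "continuous_on I f'"
  shows "weak_derivative I f f'"
  unfolding weak_derivative_def
proof (intro allI impI)
  fix \<psi> assume "test_function I \<psi>"
  then obtain K where K: "compact K" "K \<subseteq> I" "\<And>x. x \<notin> K \<Longrightarrow> \<psi> x = 0"
    and smooth: "(deriv ^^ n) \<psi> field_differentiable at x" for n x
    unfolding test_function_def by blast
  have \<psi>: "(\<psi> has_real_derivative deriv \<psi> x) (at x)" for x
    using smooth[of 0 x] by (simp add: DERIV_deriv_iff_field_differentiable)
  have \<psi>': "continuous_on UNIV (deriv \<psi>)"
    using smooth[of 1] by (auto intro!: continuous_at_imp_continuous_on field_differentiable_imp_continuous_at)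
  obtain a b where ab: "K \<subseteq> {a..b}" "{a..b} \<subseteq> I" "a \<le> b \<or> K = {}"
  proof (cases "K = {}")
    case True
    \<comment> \<open>An empty support is enclosed by the empty interval \<open>{1..0}\<close>.\<close>
    then show ?thesis using that[of 1 0] by simp
  next
    case False
    obtain a where a: "a \<in> K" "\<And>x. x \<in> K \<Longrightarrow> a \<le> x"
      using compact_attains_inf[OF K(1) False] by blast
    obtain b where b: "b \<in> K" "\<And>x. x \<in> K \<Longrightarrow> x \<le> b"
      using compact_attains_sup[OF K(1) False] by blast
    have "{a..b} \<subseteq> I"
      using assms(1) a(1) b(1) K(2) unfolding is_interval_1 by (meson atLeastAtMost_iff subset_eq)
    then show ?thesis
      using that[of a b] a b by force
  qed
  have zero: "\<psi> x = 0" "deriv \<psi> x = 0" if "x \<notin> {a..b}" for x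
  proof -
    show "\<psi> x = 0" using that ab K(3) by blast
    have "open (- {a..b})" by auto
    then have "(\<psi> has_real_derivative 0) (at x)"
      using ab(1) K(3) that
      by (intro has_field_derivative_transform_within_open[OF DERIV_const[of 0]]) auto
    then show "deriv \<psi> x = 0" by (rule DERIV_imp_deriv)
  qed
  have restrict: "(LINT x:I|lebesgue. h x) = integral {a..b} h"
    if "\<And>x. x \<notin> {a..b} \<Longrightarrow> h x = 0" "continuous_on {a..b} h" for h :: "real \<Rightarrow> real"
  proof -
    have "(LINT x:I|lebesgue. h x) = (LINT x:{a..b}|lebesgue. h x)"
      unfolding set_lebesgue_integral_def using that(1) ab(2)
      by (intro Bochner_Integration.integral_cong) (auto simp: indicator_def)
    also have "\<dots> = integral {a..b} h"
      using absolutely_integrable_continuous_real[OF that(2)]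
      by (rule set_lebesgue_integral_eq_integral(2))
    finally show ?thesis .
  qed
  have cont: "continuous_on {a..b} f" "continuous_on {a..b} f'" "continuous_on {a..b} \<psi>"
    "continuous_on {a..b} (deriv \<psi>)"
  proof -
    show "continuous_on {a..b} f"
      using f ab(2) by (intro continuous_at_imp_continuous_on) (auto intro: DERIV_isCont)
    show "continuous_on {a..b} f'"
      using f' ab(2) by (rule continuous_on_subset)
    show "continuous_on {a..b} \<psi>"
      using \<psi> by (intro continuous_at_imp_continuous_on) (auto intro: DERIV_isCont)
    show "continuous_on {a..b} (deriv \<psi>)"
      using \<psi>' by (rule continuous_on_subset) auto
  qed
  have "((\<lambda>x. f x * deriv \<psi> x + f' x * \<psi> x) has_integral 0) {a..b}"
  proof (cases "a \<le> b")
    case True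
    have "(\<psi> \<longlongrightarrow> \<psi> a) (at_left a)" "(\<psi> \<longlongrightarrow> \<psi> b) (at_right b)"
      using DERIV_isCont[OF \<psi>] by (simp_all add: isCont_def filterlim_at_split)
    moreover have "(\<psi> \<longlongrightarrow> 0) (at_left a)" "(\<psi> \<longlongrightarrow> 0) (at_right b)"
      by (rule tendsto_eventually, use zero(1) in \<open>simp add: eventually_at_filter\<close>)+
    ultimately have "\<psi> a = 0" "\<psi> b = 0"
      by (auto intro: tendsto_unique[rotated])
    moreover have "((\<lambda>x. f x * deriv \<psi> x + f' x * \<psi> x) has_integral f b * \<psi> b - f a * \<psi> a) {a..b}"
    proof (rule fundamental_theorem_of_calculus[OF True])
      fix x assume "x \<in> {a..b}"
      then have "((\<lambda>x. f x * \<psi> x) has_real_derivative f x * deriv \<psi> x + f' x * \<psi> x) (at x)"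
        using f[of x] ab(2) \<psi>[of x] by (auto intro!: derivative_eq_intros)
      then show "((\<lambda>x. f x * \<psi> x) has_vector_derivative f x * deriv \<psi> x + f' x * \<psi> x)
                  (at x within {a..b})"
        by (simp add: has_real_derivative_iff_has_vector_derivative has_vector_derivative_at_within)
    qed
    ultimately show ?thesis by simp
  next
    case False
    then show ?thesis by simp
  qed
  then have "integral {a..b} (\<lambda>x. f x * deriv \<psi> x) + integral {a..b} (\<lambda>x. f' x * \<psi> x) = 0"
    using cont
    by (subst integral_add[symmetric])
       (auto intro!: integrable_continuous_interval continuous_intros simp: integral_unique)
  then show "(LINT x:I|lebesgue. f x * deriv \<psi> x) = - (LINT x:I|lebesgue. f' x * \<psi> x)"
    using zero cont
    by (subst (1 2) restrict) (auto intro!: continuous_intros)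
qed

lemma H1_on_of_exponential_decay:
  fixes f f' :: "real \<Rightarrow> real"
  assumes I: "is_interval I" "open I"
    and f: "\<And>x. x \<in> I \<Longrightarrow> (f has_real_derivative f' x) (at x)"
    and f': "continuous_on I f'"
    and "c > 0"
    and "\<And>x. x \<in> I \<Longrightarrow> \<bar>f x\<bar> \<le> C * exp (- c * \<bar>x\<bar>)"
    and "\<And>x. x \<in> I \<Longrightarrow> \<bar>f' x\<bar> \<le> C' * exp (- c * \<bar>x\<bar>)"
  shows "H1_on I f"
proof -
  have "continuous_on I f"
    using f by (intro continuous_at_imp_continuous_on) (auto intro: DERIV_isCont)
  then show ?thesis
    unfolding H1_on_def
    using assms L2_on_of_exponential_decay[of I] weak_derivative_of_classical[OF I(1) f f'] by blast
qed

section \<open>Pairs of solitons glued at the origin\<close>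

text \<open>
  From \<open>2 cosh z \<ge> exp \<bar>z\<bar>\<close>: the power \<open>1 / (p - 2)\<close> turns the rate \<open>2 k = (p - 2) sqrt \<omega>\<close> into
  \<open>sqrt \<omega>\<close>, and moving the centre from \<open>y\<close> to the origin costs the factor \<open>exp (sqrt \<omega> * \<bar>y\<bar>)\<close>.
\<close>

lemma soliton_exponential_decay:
  assumes p: "p > 2" and \<omega>: "\<omega> > 0"
  shows "soliton p \<omega> (x - y)
           \<le> ((2 * \<omega> * p) powr (1 / (p - 2)) * exp (sqrt \<omega> * \<bar>y\<bar>)) * exp (- sqrt \<omega> * \<bar>x\<bar>)"
proof -
  define z where "z = \<bar>cosh_rate p \<omega> * (x - y)\<bar>"
  have "exp z \<le> 2 * cosh z"
    by (simp add: cosh_def)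
  then have "(exp z)\<^sup>2 \<le> (2 * cosh z)\<^sup>2"
    by (intro power_mono) auto
  moreover have "cosh z = cosh (cosh_rate p \<omega> * (x - y))"
    unfolding z_def by (rule cosh_real_abs)
  ultimately have "\<omega> * p / (2 * (cosh (cosh_rate p \<omega> * (x - y)))\<^sup>2) \<le> \<omega> * p / ((exp z)\<^sup>2 / 2)"
    using p \<omega> by (intro divide_left_mono) (auto simp: power_mult_distrib)
  also have "\<dots> = 2 * \<omega> * p * exp (- 2 * z)"
    by (simp add: exp_minus field_simps flip: exp_double)
  finally have "soliton p \<omega> (x - y) \<le> (2 * \<omega> * p * exp (- 2 * z)) powr (1 / (p - 2))"
    unfolding soliton_def using p \<omega> by (intro powr_mono2) auto
  also have "\<dots> = (2 * \<omega> * p) powr (1 / (p - 2)) * exp (- 2 * z * (1 / (p - 2)))"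
    using p \<omega> by (subst powr_mult) (auto simp: exp_powr_real)
  also have "- 2 * z * (1 / (p - 2)) = - sqrt \<omega> * \<bar>x - y\<bar>"
    using p \<omega> by (simp add: z_def abs_mult)
  also have "(2 * \<omega> * p) powr (1 / (p - 2)) * exp (- sqrt \<omega> * \<bar>x - y\<bar>)
      \<le> (2 * \<omega> * p) powr (1 / (p - 2)) * exp (sqrt \<omega> * \<bar>y\<bar> + - sqrt \<omega> * \<bar>x\<bar>)"
  proof (intro mult_left_mono)
    have "sqrt \<omega> * \<bar>x\<bar> \<le> sqrt \<omega> * (\<bar>y\<bar> + \<bar>x - y\<bar>)"
      using \<omega> by (intro mult_left_mono) auto
    then show "exp (- sqrt \<omega> * \<bar>x - y\<bar>) \<le> exp (sqrt \<omega> * \<bar>y\<bar> + - sqrt \<omega> * \<bar>x\<bar>)"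
      by (simp add: algebra_simps)
  qed simp
  finally show ?thesis
    by (simp only: exp_add mult.assoc)
qed

lemma soliton_deriv_bound:
  assumes "p > 2" "\<omega> > 0"
  shows "\<bar>soliton_deriv p \<omega> x\<bar> \<le> sqrt \<omega> * soliton p \<omega> x"
proof -
  have "\<bar>tanh (cosh_rate p \<omega> * x)\<bar> \<le> 1"
    using tanh_real_bounds[of "cosh_rate p \<omega> * x"] by auto
  then have "sqrt \<omega> * \<bar>tanh (cosh_rate p \<omega> * x)\<bar> * soliton p \<omega> x \<le> sqrt \<omega> * 1 * soliton p \<omega> x"
    using soliton_pos[OF assms, of x] assms by (intro mult_mono) auto
  then show ?thesis
    using soliton_pos[OF assms, of x] assms by (simp add: abs_mult)
qed

text \<open>
  The restriction to \<open>- {0}\<close> gives the profile the dummy value \<open>undefined\<close> at the origin, as required of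
  elements of \<open>neg_pos_solutions\<close>.  The shifts are subtracted on the right and added on the left, so that
  positive shifts put both centres inside their half-lines.
\<close>

definition glued_solitons :: "real \<Rightarrow> real \<Rightarrow> real \<Rightarrow> real \<Rightarrow> real \<Rightarrow> real" where
  "glued_solitons p \<omega> xp xm =
     (\<lambda>x\<in>- {0}. if x > 0 then soliton p \<omega> (x - xp) else - soliton p \<omega> (x + xm))"

lemma glued_solitons_simps [simp]:
  "x > 0 \<Longrightarrow> glued_solitons p \<omega> xp xm x = soliton p \<omega> (x - xp)"
  "x < 0 \<Longrightarrow> glued_solitons p \<omega> xp xm x = - soliton p \<omega> (x + xm)"
  by (auto simp: glued_solitons_def)

context
  fixes p \<omega> :: real
  assumes p: "p > 2" and \<omega>: "\<omega> > 0"
begin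

lemma glued_solitons_has_derivative:
  "x > 0 \<Longrightarrow> (glued_solitons p \<omega> xp xm has_real_derivative soliton_deriv p \<omega> (x - xp)) (at x)"
  "x < 0 \<Longrightarrow> (glued_solitons p \<omega> xp xm has_real_derivative - soliton_deriv p \<omega> (x + xm)) (at x)"
proof -
  assume "x > 0"
  have "((\<lambda>x. soliton p \<omega> (x - xp)) has_real_derivative soliton_deriv p \<omega> (x - xp)) (at x)"
    using DERIV_shift[THEN iffD1, OF soliton_has_derivative[OF p \<omega>], of "- xp" x]
    by (simp only: diff_conv_add_uminus)
  then show "(glued_solitons p \<omega> xp xm has_real_derivative soliton_deriv p \<omega> (x - xp)) (at x)"
    by (rule has_field_derivative_transform_within_open[where S = "{0<..}"]) (use \<open>x > 0\<close> in auto)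
next
  assume "x < 0"
  have "((\<lambda>x. - soliton p \<omega> (x + xm)) has_real_derivative - soliton_deriv p \<omega> (x + xm)) (at x)"
    by (intro DERIV_minus DERIV_shift[THEN iffD1] soliton_has_derivative p \<omega>)
  then show "(glued_solitons p \<omega> xp xm has_real_derivative - soliton_deriv p \<omega> (x + xm)) (at x)"
    by (rule has_field_derivative_transform_within_open[where S = "{..<0}"]) (use \<open>x < 0\<close> in auto)
qed

lemmas deriv_glued_solitons = glued_solitons_has_derivative[THEN DERIV_imp_deriv]

lemma deriv_glued_solitons_has_derivative:
  assumes "x \<noteq> 0"
  shows "(deriv (glued_solitons p \<omega> xp xm) has_real_derivative
     \<omega> * glued_solitons p \<omega> xp xm x
       - \<bar>glued_solitons p \<omega> xp xm x\<bar> powr (p - 2) * glued_solitons p \<omega> xp xm x) (at x)"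
proof (cases "x > 0")
  case True
  have "((\<lambda>x. soliton_deriv p \<omega> (x - xp)) has_real_derivative
      \<omega> * soliton p \<omega> (x - xp) - soliton p \<omega> (x - xp) powr (p - 2) * soliton p \<omega> (x - xp)) (at x)"
    using DERIV_shift[THEN iffD1, OF soliton_has_second_derivative[OF p \<omega>], of "- xp" x]
    by (simp only: diff_conv_add_uminus)
  moreover have "\<bar>soliton p \<omega> (x - xp)\<bar> = soliton p \<omega> (x - xp)"
    using soliton_pos[OF p \<omega>] by (simp add: less_imp_le)
  ultimately have "((\<lambda>x. soliton_deriv p \<omega> (x - xp)) has_real_derivative
     \<omega> * glued_solitons p \<omega> xp xm x
       - \<bar>glued_solitons p \<omega> xp xm x\<bar> powr (p - 2) * glued_solitons p \<omega> xp xm x) (at x)"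
    using True by (simp only: glued_solitons_simps)
  then show ?thesis
    by (rule has_field_derivative_transform_within_open[where S = "{0<..}"])
       (use True in \<open>auto simp: deriv_glued_solitons\<close>)
next
  case False
  then have neg: "x < 0" using assms by simp
  have "((\<lambda>x. - soliton_deriv p \<omega> (x + xm)) has_real_derivative
      - (\<omega> * soliton p \<omega> (x + xm) - soliton p \<omega> (x + xm) powr (p - 2) * soliton p \<omega> (x + xm))) (at x)"
    by (intro DERIV_minus DERIV_shift[THEN iffD1] soliton_has_second_derivative p \<omega>)
  moreover have "\<bar>- soliton p \<omega> (x + xm)\<bar> = soliton p \<omega> (x + xm)"
    using soliton_pos[OF p \<omega>] by (simp add: less_imp_le)
  ultimately have "((\<lambda>x. - soliton_deriv p \<omega> (x + xm)) has_real_derivative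
     \<omega> * glued_solitons p \<omega> xp xm x
       - \<bar>glued_solitons p \<omega> xp xm x\<bar> powr (p - 2) * glued_solitons p \<omega> xp xm x) (at x)"
    using neg by (simp add: algebra_simps)
  then show ?thesis
    by (rule has_field_derivative_transform_within_open[where S = "{..<0}"])
       (use neg in \<open>auto simp: deriv_glued_solitons\<close>)
qed

lemma continuous_soliton: "continuous_on UNIV (soliton p \<omega>)"
  using soliton_has_derivative[OF p \<omega>] by (intro DERIV_continuous_on) auto

lemma continuous_soliton_deriv: "continuous_on UNIV (soliton_deriv p \<omega>)"
  using soliton_has_second_derivative[OF p \<omega>] by (intro DERIV_continuous_on) auto

lemma glued_solitons_limits:
  "(glued_solitons p \<omega> xp xm \<longlongrightarrow> soliton p \<omega> xp) (at_right 0)"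
  "(glued_solitons p \<omega> xp xm \<longlongrightarrow> - soliton p \<omega> xm) (at_left 0)"
  "(deriv (glued_solitons p \<omega> xp xm) \<longlongrightarrow> - soliton_deriv p \<omega> xp) (at_right 0)"
  "(deriv (glued_solitons p \<omega> xp xm) \<longlongrightarrow> - soliton_deriv p \<omega> xm) (at_left 0)"
proof -
  have cont: "isCont (\<lambda>x. f (x + y)) (0::real)" if "continuous_on UNIV f" for f :: "real \<Rightarrow> real" and y
    using that continuous_on_compose2[OF that, of UNIV "\<lambda>x. x + y"]
    by (auto simp: continuous_on_eq_continuous_at intro!: continuous_intros)
  have right: "((\<lambda>x. f (x + y)) \<longlongrightarrow> f y) (at_right 0)" and left: "((\<lambda>x. f (x + y)) \<longlongrightarrow> f y) (at_left 0)"
    if "continuous_on UNIV f" for f :: "real \<Rightarrow> real" and y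
    using cont[OF that, of y] by (simp_all add: isCont_def filterlim_at_split)
  have ev: "\<forall>\<^sub>F x in at_right (0::real). x > 0" "\<forall>\<^sub>F x in at_left (0::real). x < 0"
    by (simp_all add: eventually_at_filter)
  have "\<forall>\<^sub>F x in at_right 0. glued_solitons p \<omega> xp xm x = soliton p \<omega> (x + (- xp))"
    using ev(1) by eventually_elim simp
  then show "(glued_solitons p \<omega> xp xm \<longlongrightarrow> soliton p \<omega> xp) (at_right 0)"
    using right[OF continuous_soliton, of "- xp"] by (simp add: tendsto_cong)
  have "\<forall>\<^sub>F x in at_left 0. glued_solitons p \<omega> xp xm x = - soliton p \<omega> (x + xm)"
    using ev(2) by eventually_elim simp
  then show "(glued_solitons p \<omega> xp xm \<longlongrightarrow> - soliton p \<omega> xm) (at_left 0)"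
    using tendsto_minus[OF left[OF continuous_soliton, of xm]] by (simp add: tendsto_cong)
  have "\<forall>\<^sub>F x in at_right 0. deriv (glued_solitons p \<omega> xp xm) x = soliton_deriv p \<omega> (x + (- xp))"
    using ev(1) by eventually_elim (simp add: deriv_glued_solitons)
  then show "(deriv (glued_solitons p \<omega> xp xm) \<longlongrightarrow> - soliton_deriv p \<omega> xp) (at_right 0)"
    using right[OF continuous_soliton_deriv, of "- xp"] by (simp add: tendsto_cong)
  have "\<forall>\<^sub>F x in at_left 0. deriv (glued_solitons p \<omega> xp xm) x = - soliton_deriv p \<omega> (x + xm)"
    using ev(2) by eventually_elim (simp add: deriv_glued_solitons)
  then show "(deriv (glued_solitons p \<omega> xp xm) \<longlongrightarrow> - soliton_deriv p \<omega> xm) (at_left 0)"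
    using tendsto_minus[OF left[OF continuous_soliton_deriv, of xm]] by (simp add: tendsto_cong)
qed

lemma glued_solitons_H1:
  "H1_on {0<..} (glued_solitons p \<omega> xp xm)" "H1_on {..<0} (glued_solitons p \<omega> xp xm)"
proof -
  define C where "C = (\<lambda>y. (2 * \<omega> * p) powr (1 / (p - 2)) * exp (sqrt \<omega> * \<bar>y\<bar>))"
  have decay: "\<bar>soliton p \<omega> (x + y)\<bar> \<le> C y * exp (- sqrt \<omega> * \<bar>x\<bar>)"
    "\<bar>soliton_deriv p \<omega> (x + y)\<bar> \<le> (sqrt \<omega> * C y) * exp (- sqrt \<omega> * \<bar>x\<bar>)" for x y
  proof -
    have 1: "soliton p \<omega> (x + y) \<le> C y * exp (- sqrt \<omega> * \<bar>x\<bar>)"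
      using soliton_exponential_decay[OF p \<omega>, of x "- y"] by (simp add: C_def)
    with soliton_pos[OF p \<omega>, of "x + y"]
    show "\<bar>soliton p \<omega> (x + y)\<bar> \<le> C y * exp (- sqrt \<omega> * \<bar>x\<bar>)"
      by simp
    have "\<bar>soliton_deriv p \<omega> (x + y)\<bar> \<le> sqrt \<omega> * (C y * exp (- sqrt \<omega> * \<bar>x\<bar>))"
      using soliton_deriv_bound[OF p \<omega>, of "x + y"] mult_left_mono[OF 1, of "sqrt \<omega>"] \<omega>
      by (meson less_imp_le order_trans real_sqrt_ge_zero)
    then show "\<bar>soliton_deriv p \<omega> (x + y)\<bar> \<le> (sqrt \<omega> * C y) * exp (- sqrt \<omega> * \<bar>x\<bar>)"
      by (simp only: mult.assoc)
  qed
  have cont: "continuous_on I (\<lambda>x. soliton_deriv p \<omega> (x + y))" for I y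
    by (rule continuous_on_compose2[OF continuous_soliton_deriv]) (auto intro!: continuous_intros)
  show "H1_on {0<..} (glued_solitons p \<omega> xp xm)"
  proof (rule H1_on_of_exponential_decay)
    show "(glued_solitons p \<omega> xp xm has_real_derivative soliton_deriv p \<omega> (x + (- xp))) (at x)"
      if "x \<in> {0<..}" for x
      using that glued_solitons_has_derivative(1) by simp
    show "\<bar>glued_solitons p \<omega> xp xm x\<bar> \<le> C (- xp) * exp (- sqrt \<omega> * \<bar>x\<bar>)" if "x \<in> {0<..}" for x
      using that decay(1)[of x "- xp"] by simp
    show "\<bar>soliton_deriv p \<omega> (x + (- xp))\<bar> \<le> (sqrt \<omega> * C (- xp)) * exp (- sqrt \<omega> * \<bar>x\<bar>)"
      if "x \<in> {0<..}" for x
      by (rule decay(2))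
    show "continuous_on {0<..} (\<lambda>x. soliton_deriv p \<omega> (x + (- xp)))"
      by (rule cont)
  qed (use \<omega> in \<open>auto simp: is_interval_def\<close>)
  show "H1_on {..<0} (glued_solitons p \<omega> xp xm)"
  proof (rule H1_on_of_exponential_decay)
    show "(glued_solitons p \<omega> xp xm has_real_derivative - soliton_deriv p \<omega> (x + xm)) (at x)"
      if "x \<in> {..<0}" for x
      using that by (intro glued_solitons_has_derivative) simp
    show "\<bar>glued_solitons p \<omega> xp xm x\<bar> \<le> C xm * exp (- sqrt \<omega> * \<bar>x\<bar>)" if "x \<in> {..<0}" for x
      using that decay(1)[of x xm] by simp
    show "\<bar>- soliton_deriv p \<omega> (x + xm)\<bar> \<le> (sqrt \<omega> * C xm) * exp (- sqrt \<omega> * \<bar>x\<bar>)" if "x \<in> {..<0}" for x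
      using decay(2)[of x xm] by simp
    show "continuous_on {..<0} (\<lambda>x. - soliton_deriv p \<omega> (x + xm))"
      by (intro continuous_on_minus cont)
  qed (use \<omega> in \<open>auto simp: is_interval_def\<close>)
qed

text \<open>
  The equation off the origin holds for all shifts, so only the conditions on the one-sided limits
  remain; these limits are unique.
\<close>

lemma glued_solitons_solve_iff:
  "solves_system \<beta> p \<omega> (glued_solitons p \<omega> xp xm) \<longleftrightarrow>
     soliton_deriv p \<omega> xp = soliton_deriv p \<omega> xm \<and>
     soliton p \<omega> xp + soliton p \<omega> xm = - \<beta> * soliton_deriv p \<omega> xp"
    (is "?S \<longleftrightarrow> ?J")
proof
  let ?u = "glued_solitons p \<omega> xp xm"
  note lim = glued_solitons_limits[of xp xm]
  assume ?S
  then obtain a b c where "(?u \<longlongrightarrow> a) (at_right 0)" "(?u \<longlongrightarrow> b) (at_left 0)"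
      "(deriv ?u \<longlongrightarrow> c) (at_right 0)" "(deriv ?u \<longlongrightarrow> c) (at_left 0)" and *: "a - b = \<beta> * c"
    unfolding solves_system_def by blast
  then have a: "a = soliton p \<omega> xp" and b: "b = - soliton p \<omega> xm"
      and c: "c = - soliton_deriv p \<omega> xp" "c = - soliton_deriv p \<omega> xm"
    using lim tendsto_unique[OF trivial_limit_at_right_real] tendsto_unique[OF trivial_limit_at_left_real]
    by blast+
  from c have "soliton_deriv p \<omega> xp = soliton_deriv p \<omega> xm" by linarith
  moreover have "soliton p \<omega> xp + soliton p \<omega> xm = - \<beta> * soliton_deriv p \<omega> xp"
    using *[unfolded a b c(1)] by simp
  ultimately show ?J ..
next
  let ?u = "glued_solitons p \<omega> xp xm"
  assume J: ?J
  show ?S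
    unfolding solves_system_def
  proof (intro conjI allI impI exI)
    fix x :: real assume "x \<noteq> 0"
    then show "?u field_differentiable at x"
      using glued_solitons_has_derivative unfolding field_differentiable_def by (metis linorder_neqE_linordered_idom)
    show "deriv ?u field_differentiable at x"
      using deriv_glued_solitons_has_derivative[OF \<open>x \<noteq> 0\<close>] unfolding field_differentiable_def by blast
    show "- deriv (deriv ?u) x + \<omega> * ?u x - \<bar>?u x\<bar> powr (p - 2) * ?u x = 0"
      using DERIV_imp_deriv[OF deriv_glued_solitons_has_derivative[OF \<open>x \<noteq> 0\<close>, of xp xm]] by simp
  next
    show "- soliton_deriv p \<omega> xp = - soliton_deriv p \<omega> xm"
      using J by linarith
    show "soliton p \<omega> xp - - soliton p \<omega> xm = \<beta> * - soliton_deriv p \<omega> xp"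
      using J by simp
  qed (rule glued_solitons_limits)+
qed

text \<open>
  With positive shifts, both maxima lie inside the half-lines on which the solitons are
  used, so the profile determines the shifts.
\<close>

lemma glued_solitons_inject:
  assumes "xp > 0" "xm > 0" and eq: "glued_solitons p \<omega> xp xm = glued_solitons p \<omega> xp' xm'"
  shows "xp = xp' \<and> xm = xm'"
proof -
  have "soliton p \<omega> 0 = soliton p \<omega> (xp - xp')"
    using fun_cong[OF eq, of xp] assms(1) by simp
  moreover have "soliton p \<omega> 0 = soliton p \<omega> (- xm + xm')"
    using fun_cong[OF eq, of "- xm"] assms(2) by simp
  ultimately show ?thesis
    using soliton_strict_max[OF p \<omega>, of "xp - xp'"] soliton_strict_max[OF p \<omega>, of "- xm + xm'"]
    by force
qed

lemma odd_glued_solitons_iff: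
  assumes "xp > 0" "xm > 0"
  shows "odd_function (glued_solitons p \<omega> xp xm) \<longleftrightarrow> xp = xm"
proof
  assume "odd_function (glued_solitons p \<omega> xp xm)"
  then have "glued_solitons p \<omega> xp xm (- xp) = - glued_solitons p \<omega> xp xm xp"
    using assms(1) by (auto simp only: odd_function_def less_irrefl)
  then have "soliton p \<omega> (- xp + xm) = soliton p \<omega> 0"
    using assms by simp
  then have "- xp + xm = 0"
    using soliton_strict_max[OF p \<omega>, of "- xp + xm"] by force
  then show "xp = xm" by simp
next
  assume "xp = xm"
  moreover have "soliton p \<omega> (- x + xm) = soliton p \<omega> (x - xm)" for x
    using soliton_minus[of p \<omega> "x - xm"] by simp
  moreover have "soliton p \<omega> (- x - xm) = soliton p \<omega> (x + xm)" for x
    using soliton_minus[of p \<omega> "x + xm"] by (simp add: algebra_simps)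
  ultimately show "odd_function (glued_solitons p \<omega> xp xm)"
    unfolding odd_function_def by (auto simp: linorder_neq_iff)
qed

end

section \<open>The hyperbolic tangent system\<close>

definition tanh_system :: "real \<Rightarrow> real \<Rightarrow> real \<Rightarrow> real \<Rightarrow> real \<Rightarrow> bool" where
  "tanh_system \<beta> p \<omega> tp tm \<longleftrightarrow>
     tp * (1 - tp\<^sup>2) powr (1 / (p - 2)) = tm * (1 - tm\<^sup>2) powr (1 / (p - 2)) \<and>
     inverse tp + inverse tm = \<beta> * sqrt \<omega>"

context
  fixes \<beta> p \<omega> :: real
  assumes \<beta>: "\<beta> > 0" and p: "p > 2" and \<omega>: "\<omega> > 0"
begin

text \<open>
  Write \<open>f\<close> for \<open>(1 - t\<^sup>2) powr (1 / (p - 2))\<close>, a positive multiple of the soliton.  Continuity of the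
  derivative says that \<open>D = t f\<close> is the same on both sides; the jump of \<open>u\<close> is then a multiple of
  \<open>D / t\<^sub>+ + D / t\<^sub>-\<close>, and division by \<open>D\<close> gives the second equation.  The jump is positive, since \<open>u\<close> changes
  sign from minus to plus; with \<open>\<beta> > 0\<close> this makes \<open>D\<close> and therefore both shifts positive.
\<close>

lemma jump_conditions_iff_tanh_system:
  "soliton_deriv p \<omega> xp = soliton_deriv p \<omega> xm \<and>
   soliton p \<omega> xp + soliton p \<omega> xm = - \<beta> * soliton_deriv p \<omega> xp \<longleftrightarrow>
   xp > 0 \<and> xm > 0 \<and>
   tanh_system \<beta> p \<omega> (tanh (cosh_rate p \<omega> * xp)) (tanh (cosh_rate p \<omega> * xm))"
    (is "?J \<longleftrightarrow> ?T")
proof -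
  define r tp tm where "r = sqrt \<omega>" and "tp = tanh (cosh_rate p \<omega> * xp)"
    and "tm = tanh (cosh_rate p \<omega> * xm)"
  define A fp fm where "A = (\<omega> * p / 2) powr (1 / (p - 2))"
    and "fp = (1 - tp\<^sup>2) powr (1 / (p - 2))" and "fm = (1 - tm\<^sup>2) powr (1 / (p - 2))"
  have "A > 0" "r > 0"
    using p \<omega> by (simp_all add: A_def r_def)
  have "fp > 0" "fm > 0"
    using one_minus_tanh_squared_pos[of "cosh_rate p \<omega> * xp"]
      one_minus_tanh_squared_pos[of "cosh_rate p \<omega> * xm"]
    unfolding fp_def fm_def tp_def tm_def by simp_all
  have sol: "soliton p \<omega> xp = A * fp" "soliton p \<omega> xm = A * fm"
    by (simp_all add: soliton_eq_tanh[OF p \<omega>] A_def fp_def fm_def tp_def tm_def)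
  have der: "soliton_deriv p \<omega> xp = - (r * tp * (A * fp))" "soliton_deriv p \<omega> xm = - (r * tm * (A * fm))"
    by (simp_all only: sol r_def tp_def tm_def)
  have sign: "xp > 0 \<longleftrightarrow> tp > 0" "xm > 0 \<longleftrightarrow> tm > 0"
    using p \<omega> by (auto simp: tp_def tm_def zero_less_mult_iff mult_less_0_iff)
  have "?J \<longleftrightarrow> r * tp * (A * fp) = r * tm * (A * fm) \<and> A * fp + A * fm = \<beta> * (r * tp * (A * fp))"
    unfolding der unfolding sol by auto
  also have "\<dots> \<longleftrightarrow> tp * fp = tm * fm \<and> fp + fm = \<beta> * r * (tp * fp)"
  proof -
    have "r * tp * (A * fp) = r * tm * (A * fm) \<longleftrightarrow> (r * A) * (tp * fp) = (r * A) * (tm * fm)"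
      by (simp only: mult_ac)
    also have "\<dots> \<longleftrightarrow> tp * fp = tm * fm"
      using \<open>A > 0\<close> \<open>r > 0\<close> by simp
    finally have 1: "r * tp * (A * fp) = r * tm * (A * fm) \<longleftrightarrow> tp * fp = tm * fm" .
    have "A * fp + A * fm = \<beta> * (r * tp * (A * fp)) \<longleftrightarrow> A * (fp + fm) = A * (\<beta> * r * (tp * fp))"
      by (simp add: algebra_simps)
    also have "\<dots> \<longleftrightarrow> fp + fm = \<beta> * r * (tp * fp)"
      using \<open>A > 0\<close> by simp
    finally show ?thesis using 1 by simp
  qed
  also have "\<dots> \<longleftrightarrow> tp > 0 \<and> tm > 0 \<and> tp * fp = tm * fm \<and> inverse tp + inverse tm = \<beta> * r"
  proof (cases "tp > 0 \<and> tm > 0 \<and> tp * fp = tm * fm")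
    case True
    define D where "D = tp * fp"
    have "D = tm * fm"
      using True by (simp add: D_def)
    then have D: "D > 0" "fp = D * inverse tp" "fm = D * inverse tm"
      using True \<open>fm > 0\<close> by (auto simp: D_def field_simps)
    have "fp + fm = D * (inverse tp + inverse tm)"
      using D(2,3) by (simp only: distrib_left)
    then have "fp + fm = \<beta> * r * (tp * fp) \<longleftrightarrow> D * (inverse tp + inverse tm) = D * (\<beta> * r)"
      unfolding D_def[symmetric] by (simp only: mult_ac)
    also have "\<dots> \<longleftrightarrow> inverse tp + inverse tm = \<beta> * r"
      using D(1) by simp
    finally show ?thesis using True by simp
  next
    case False
    have "tp > 0 \<and> tm > 0" if "tp * fp = tm * fm" "fp + fm = \<beta> * r * (tp * fp)"
    proof -
      have "\<beta> * r * (tp * fp) > 0"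
        using that(2) \<open>fp > 0\<close> \<open>fm > 0\<close> by linarith
      then have "tp * fp > 0"
        by (rule zero_less_mult_pos) (use \<beta> \<open>r > 0\<close> in simp)
      moreover from this have "tm * fm > 0"
        using that(1) by simp
      ultimately show ?thesis
        using \<open>fp > 0\<close> \<open>fm > 0\<close> by (simp add: zero_less_mult_iff)
    qed
    with False show ?thesis by blast
  qed
  finally show ?thesis
    unfolding tanh_system_def sign tp_def[symmetric] tm_def[symmetric] fp_def fm_def r_def by simp
qed

text \<open>
  The right half is a positive half-line solution, and so is the reflection \<open>x \<mapsto> - u (- x)\<close> of the
  left half, because the equation is invariant under both sign changes.
\<close>

lemma neg_pos_solution_is_glued_soliton:
  assumes "u \<in> neg_pos_solutions \<beta> p \<omega>"
  obtains xp xm where "u = glued_solitons p \<omega> xp xm"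
proof -
  have ext: "u \<in> extensional (- {0})" and H1: "H1_on {..<0} u" "H1_on {0<..} u"
    and sys: "solves_system \<beta> p \<omega> u"
    and neg: "\<And>x. x < 0 \<Longrightarrow> u x < 0" and pos: "\<And>x. x > 0 \<Longrightarrow> u x > 0"
    using assms by (auto simp: neg_pos_solutions_def)
  have ode: "(u has_real_derivative deriv u x) (at x)"
    "(deriv u has_real_derivative \<omega> * u x - \<bar>u x\<bar> powr (p - 2) * u x) (at x)" if "x \<noteq> 0" for x
  proof -
    have *: "u field_differentiable at x" "deriv u field_differentiable at x"
      "- deriv (deriv u) x + \<omega> * u x - \<bar>u x\<bar> powr (p - 2) * u x = 0"
      using sys that unfolding solves_system_def by blast+
    show "(u has_real_derivative deriv u x) (at x)"
      using *(1) by (simp add: DERIV_deriv_iff_field_differentiable)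
    have "deriv (deriv u) x = \<omega> * u x - \<bar>u x\<bar> powr (p - 2) * u x"
      using *(3) by simp
    then show "(deriv u has_real_derivative \<omega> * u x - \<bar>u x\<bar> powr (p - 2) * u x) (at x)"
      using *(2) by (simp flip: DERIV_deriv_iff_field_differentiable)
  qed
  have L2: "integral {a..b} (\<lambda>x. (u x)\<^sup>2) \<le> integral I (\<lambda>x. (u x)\<^sup>2)"
    if "H1_on I u" "{a..b} \<subseteq> I" "{a..b} \<subseteq> - {0}" for a b I
  proof (rule integral_subset_le[OF that(2)])
    have "set_integrable lebesgue I (\<lambda>x. (u x)\<^sup>2)"
      using that(1) by (simp add: H1_on_def L2_on_def)
    then show "(\<lambda>x. (u x)\<^sup>2) integrable_on I"
      by (rule set_lebesgue_integral_eq_integral)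
    have "continuous_on {a..b} u"
      by (rule DERIV_continuous_on, rule has_field_derivative_at_within, rule ode(1))
         (use that(3) in auto)
    then show "(\<lambda>x. (u x)\<^sup>2) integrable_on {a..b}"
      by (intro integrable_continuous_interval continuous_intros)
  qed simp
  have "\<exists>y. \<forall>x>0. u x = soliton p \<omega> (x - y)"
  proof (rule half_line_solution_is_soliton[OF p \<omega>, of u "deriv u" "integral {0<..} (\<lambda>x. (u x)\<^sup>2)"])
    show "(deriv u has_real_derivative \<omega> * u x - u x powr (p - 1)) (at x)" if "x > 0" for x
      using ode(2)[of x] pos[OF that] that by (simp add: powr_diff powr_numeral power2_eq_square field_simps)
    show "integral {1..x} (\<lambda>t. (u t)\<^sup>2) \<le> integral {0<..} (\<lambda>x. (u x)\<^sup>2)" if "x \<ge> 1" for x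
      by (rule L2[OF H1(2)]) auto
  qed (use pos ode(1) in auto)
  then obtain xp where xp: "\<And>x. x > 0 \<Longrightarrow> u x = soliton p \<omega> (x - xp)"
    by blast
  define v v' where "v = (\<lambda>x. - u (- x))" and "v' = (\<lambda>x. deriv u (- x))"
  have vpos: "v x > 0" if "x > 0" for x
    using neg[of "- x"] that by (simp add: v_def)
  have "\<exists>y. \<forall>x>0. v x = soliton p \<omega> (x - y)"
  proof (rule half_line_solution_is_soliton[OF p \<omega>, of v v' "integral {..<0} (\<lambda>x. (u x)\<^sup>2)"])
    show "(v has_real_derivative v' x) (at x)" if "x > 0" for x
    proof -
      have "((\<lambda>x. u (- x)) has_real_derivative deriv u (- x) * - 1) (at x)"
        by (rule DERIV_chain2[OF ode(1)]) (use that in \<open>auto intro!: derivative_eq_intros\<close>)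
      from DERIV_minus[OF this] show ?thesis
        by (simp add: v_def v'_def)
    qed
    show "(v' has_real_derivative \<omega> * v x - v x powr (p - 1)) (at x)" if "x > 0" for x
    proof -
      have "(v' has_real_derivative (\<omega> * u (- x) - \<bar>u (- x)\<bar> powr (p - 2) * u (- x)) * - 1) (at x)"
        unfolding v'_def by (rule DERIV_chain2[OF ode(2)]) (use that in \<open>auto intro!: derivative_eq_intros\<close>)
      moreover have "(\<omega> * u (- x) - \<bar>u (- x)\<bar> powr (p - 2) * u (- x)) * - 1 = \<omega> * v x - v x powr (p - 2) * v x"
        using neg[of "- x"] that by (simp add: v_def algebra_simps)
      moreover have "v x powr (p - 2) * v x = v x powr (p - 1)"
        using vpos[OF that] by (simp add: powr_diff powr_numeral power2_eq_square)
      ultimately show ?thesis by (simp only:)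
    qed
    show "integral {1..x} (\<lambda>t. (v t)\<^sup>2) \<le> integral {..<0} (\<lambda>x. (u x)\<^sup>2)" if "x \<ge> 1" for x
    proof -
      have "integral {1..x} (\<lambda>t. (v t)\<^sup>2) = integral {- x..- 1} (\<lambda>t. (u t)\<^sup>2)"
        using Henstock_Kurzweil_Integration.integral_reflect_real[of "- 1" "- x" "\<lambda>t. (u t)\<^sup>2"]
        by (simp add: v_def)
      also have "\<dots> \<le> integral {..<0} (\<lambda>x. (u x)\<^sup>2)"
        by (rule L2[OF H1(1)]) auto
      finally show ?thesis .
    qed
  qed (use vpos in auto)
  then obtain xm where xm: "\<And>x. x > 0 \<Longrightarrow> v x = soliton p \<omega> (x - xm)"
    by blast
  have "u x = - soliton p \<omega> (x + xm)" if "x < 0" for x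
    using xm[of "- x"] soliton_minus[of p \<omega> "x + xm"] that by (simp add: v_def algebra_simps)
  then have "u = glued_solitons p \<omega> xp xm"
    using xp ext by (intro extensionalityI[of _ "- {0}"]) (auto simp: glued_solitons_def linorder_neq_iff)
  then show ?thesis by (rule that)
qed

lemma neg_pos_solutions_eq:
  "neg_pos_solutions \<beta> p \<omega> =
     {glued_solitons p \<omega> xp xm | xp xm. xp > 0 \<and> xm > 0 \<and>
        tanh_system \<beta> p \<omega> (tanh (cosh_rate p \<omega> * xp)) (tanh (cosh_rate p \<omega> * xm))}"
    (is "_ = ?R")
proof -
  have iff: "glued_solitons p \<omega> xp xm \<in> neg_pos_solutions \<beta> p \<omega> \<longleftrightarrow> xp > 0 \<and> xm > 0 \<and>
        tanh_system \<beta> p \<omega> (tanh (cosh_rate p \<omega> * xp)) (tanh (cosh_rate p \<omega> * xm))" for xp xm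
  proof -
    have "glued_solitons p \<omega> xp xm \<in> extensional (- {0})"
      by (simp add: glued_solitons_def)
    moreover have "\<forall>x<0. glued_solitons p \<omega> xp xm x < 0" "\<forall>x>0. glued_solitons p \<omega> xp xm x > 0"
      using soliton_pos[OF p \<omega>] by simp_all
    ultimately have "glued_solitons p \<omega> xp xm \<in> neg_pos_solutions \<beta> p \<omega>
        \<longleftrightarrow> solves_system \<beta> p \<omega> (glued_solitons p \<omega> xp xm)"
      using glued_solitons_H1[OF p \<omega>, of xp xm] unfolding neg_pos_solutions_def by blast
    then show ?thesis
      unfolding glued_solitons_solve_iff[OF p \<omega>] jump_conditions_iff_tanh_system .
  qed
  show ?thesis
  proof (intro equalityI subsetI)
    fix u assume "u \<in> neg_pos_solutions \<beta> p \<omega>"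
    moreover from this obtain xp xm where "u = glued_solitons p \<omega> xp xm"
      by (rule neg_pos_solution_is_glued_soliton)
    ultimately show "u \<in> ?R"
      using iff by blast
  qed (use iff in auto)
qed

end

section \<open>Counting the solutions of the tangent system\<close>

text \<open>
  The logarithm of \<open>t (1 - t\<^sup>2) powr a\<close> in terms of \<open>s = 1 / t > 1\<close>; see \<open>ln_eq_level\<close>.
\<close>

definition level :: "real \<Rightarrow> real \<Rightarrow> real" where
  "level a s = a * ln (s - 1) + a * ln (s + 1) - (1 + 2 * a) * ln s"

text \<open>
  The bound on \<open>d\<close> keeps both \<open>m - d\<close> and \<open>m + d\<close> above 1, the range of \<open>1 / t\<close>.
\<close>

definition splits :: "real \<Rightarrow> real \<Rightarrow> real set" where
  "splits a m = {d. \<bar>d\<bar> < m - 1 \<and> level a (m + d) = level a (m - d)}"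

text \<open>
  The part of the derivative of the gap \<open>level a (m + d) - level a (m - d)\<close> that governs its
  sign, as a function of \<open>y = d\<^sup>2\<close>.  It comes from putting the six partial fractions
  in the coefficient of \<open>a\<close> over a common denominator.
\<close>

definition gap_slope :: "real \<Rightarrow> real \<Rightarrow> real" where
  "gap_slope m y = (m\<^sup>2 - 1 + 3 * y) / (((m - 1)\<^sup>2 - y) * ((m + 1)\<^sup>2 - y))"

text \<open>
  The logarithms pair up under \<open>d \<mapsto> - d\<close>, so the derivative is a rational function of \<open>d\<^sup>2\<close>.  The
  prefactor is positive, and the sign is that of \<open>2 * a * gap_slope m (d\<^sup>2) - 1\<close>.
\<close>

lemma gap_has_derivative:
  assumes "\<bar>d\<bar> < m - 1"
  shows "((\<lambda>d. level a (m + d) - level a (m - d)) has_real_derivative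
           2 * m / (m\<^sup>2 - d\<^sup>2) * (2 * a * gap_slope m (d\<^sup>2) - 1)) (at d)"
proof -
  have pos: "m + d - 1 > 0" "m - d - 1 > 0" "m + d + 1 > 0" "m - d + 1 > 0" "m + d > 0" "m - d > 0"
    using assms by auto
  have der: "((\<lambda>d. level a (m + d) - level a (m - d)) has_real_derivative
      a * (1 / (m + d - 1) + 1 / (m - d - 1) + 1 / (m + d + 1) + 1 / (m - d + 1) - 2 / (m + d) - 2 / (m - d))
      - (1 / (m + d) + 1 / (m - d))) (at d)"
    unfolding level_def using pos
    by (auto intro!: derivative_eq_intros simp: algebra_simps)
  have log_part: "1 / (m + d) + 1 / (m - d) = 2 * m / (m\<^sup>2 - d\<^sup>2)"
  proof -
    have "m\<^sup>2 - d\<^sup>2 = (m + d) * (m - d)" by (simp add: power2_eq_square algebra_simps)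
    then show ?thesis using pos by (simp add: add_frac_eq)
  qed
  have a_part: "1 / (m + d - 1) + 1 / (m - d - 1) + 1 / (m + d + 1) + 1 / (m - d + 1) - 2 / (m + d) - 2 / (m - d)
      = 2 * m / (m\<^sup>2 - d\<^sup>2) * (2 * gap_slope m (d\<^sup>2))"
  proof -
    define X Y Z where "X = (m - 1)\<^sup>2 - d\<^sup>2" and "Y = (m + 1)\<^sup>2 - d\<^sup>2" and "Z = m\<^sup>2 - d\<^sup>2"
    have fac: "X = (m + d - 1) * (m - d - 1)" "Y = (m + d + 1) * (m - d + 1)" "Z = (m + d) * (m - d)"
      by (simp_all add: X_def Y_def Z_def power2_eq_square algebra_simps)
    have nz: "X \<noteq> 0" "Y \<noteq> 0" "Z \<noteq> 0"
      unfolding fac using pos by simp_all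
    have "1 / (m + d - 1) + 1 / (m - d - 1) = 2 * (m - 1) / X"
      "1 / (m + d + 1) + 1 / (m - d + 1) = 2 * (m + 1) / Y"
      "2 / (m + d) + 2 / (m - d) = 4 * m / Z"
      unfolding fac using pos by (simp_all add: add_frac_eq)
    then have "1 / (m + d - 1) + 1 / (m - d - 1) + 1 / (m + d + 1) + 1 / (m - d + 1) - 2 / (m + d) - 2 / (m - d)
      = 2 * (m - 1) / X + 2 * (m + 1) / Y - 4 * m / Z"
      by linarith
    also have "\<dots> = (2 * (m - 1) * Y * Z + 2 * (m + 1) * X * Z - 4 * m * X * Y) / (X * Y * Z)"
      using nz by (simp add: field_simps)
    also have "2 * (m - 1) * Y * Z + 2 * (m + 1) * X * Z - 4 * m * X * Y = 4 * m * (m\<^sup>2 - 1 + 3 * d\<^sup>2)"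
      unfolding X_def Y_def Z_def by algebra
    finally show ?thesis
      unfolding gap_slope_def X_def[symmetric] Y_def[symmetric] Z_def[symmetric] by (simp add: mult_ac)
  qed
  have "a * (w * (2 * g)) - w = w * (2 * a * g - 1)" for w g :: real
    by (simp add: algebra_simps)
  then show ?thesis
    using der unfolding a_part log_part by (simp only:)
qed

text \<open>
  The numerator increases, and both factors of the denominator are positive and decrease.
\<close>

lemma gap_slope_strict_mono:
  assumes "m > 1" "0 \<le> y" "y < z" "z < (m - 1)\<^sup>2"
  shows "gap_slope m y < gap_slope m z"
proof -
  have "(m - 1)\<^sup>2 \<le> (m + 1)\<^sup>2"
    using assms by (intro power_mono) auto
  moreover have "m\<^sup>2 - 1 > 0"
    using assms by simp
  ultimately have "z < (m + 1)\<^sup>2" "0 < m\<^sup>2 - 1 + 3 * y"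
    using assms by linarith+
  then show ?thesis
    unfolding gap_slope_def using assms
    by (intro frac_less2 mult_strict_mono mult_pos_pos) (auto intro: less_imp_le mult_mono)
qed

lemma gap_slope_0:
  assumes "m > 1"
  shows "gap_slope m 0 = 1 / (m\<^sup>2 - 1)"
proof -
  have "(m - 1)\<^sup>2 * (m + 1)\<^sup>2 = (m\<^sup>2 - 1) * (m\<^sup>2 - 1)"
    by (simp add: power2_eq_square algebra_simps)
  moreover have "m\<^sup>2 - 1 > 0" using assms by simp
  ultimately show ?thesis by (simp add: gap_slope_def)
qed

text \<open>
  Two parameters with the same gap enclose a critical point, where \<open>gap_slope\<close> takes a prescribed
  value; strict monotonicity allows this only once.
\<close>

lemma gap_Rolle:
  assumes "0 \<le> d" "d < e" "e < m - 1"
    and "level a (m + d) - level a (m - d) = level a (m + e) - level a (m - e)"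
  obtains z where "d < z" "z < e" "2 * a * gap_slope m (z\<^sup>2) = 1"
proof -
  let ?H = "\<lambda>d. level a (m + d) - level a (m - d)"
  let ?H' = "\<lambda>d. 2 * m / (m\<^sup>2 - d\<^sup>2) * (2 * a * gap_slope m (d\<^sup>2) - 1)"
  have der: "(?H has_real_derivative ?H' x) (at x)" if "d \<le> x" "x \<le> e" for x
    using that assms by (intro gap_has_derivative) auto
  obtain z where z: "d < z" "z < e" "?H e - ?H d = (e - d) * ?H' z"
    using MVT2[OF assms(2) der] by blast
  have "\<bar>z\<bar> < \<bar>m\<bar>" 
    using z assms by linarith
  then have "z\<^sup>2 < m\<^sup>2"
    using power_strict_mono[of "\<bar>z\<bar>" "\<bar>m\<bar>" 2] by simp
  moreover have "m \<noteq> 0" using z assms by linarith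
  ultimately have "2 * a * gap_slope m (z\<^sup>2) = 1"
    using z assms by auto
  with z that show ?thesis by blast
qed

text \<open>
  The gap vanishes at \<open>0\<close>, so two positive zeros would give two critical points.
\<close>

lemma positive_split_unique:
  assumes "d \<in> splits a m" "e \<in> splits a m" "0 < d" "0 < e"
  shows "d = e"
proof -
  have False if de: "d \<in> splits a m" "e \<in> splits a m" "0 < d" "d < e" for d e
  proof -
    obtain x where x: "0 < x" "x < d" "2 * a * gap_slope m (x\<^sup>2) = 1"
      using gap_Rolle[of 0 d m a] de by (auto simp: splits_def)
    obtain y where y: "d < y" "y < e" "2 * a * gap_slope m (y\<^sup>2) = 1"
      using gap_Rolle[of d e m a] de by (auto simp: splits_def)
    have "x\<^sup>2 < y\<^sup>2" "y\<^sup>2 < (m - 1)\<^sup>2"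
      using x y de by (auto intro!: power_strict_mono simp: splits_def)
    then have "gap_slope m (x\<^sup>2) < gap_slope m (y\<^sup>2)"
      using de by (intro gap_slope_strict_mono) (auto simp: splits_def)
    moreover have "a \<noteq> 0" using x by auto
    then have "gap_slope m (x\<^sup>2) = gap_slope m (y\<^sup>2)"
      using x(3) y(3) by (metis mult_left_cancel mult_eq_0_iff zero_neq_numeral)
    ultimately show False by simp
  qed
  then show ?thesis
    using assms by (metis linorder_neqE_linordered_idom)
qed

text \<open>
  The critical point between \<open>0\<close> and a positive zero forces \<open>2 * a * gap_slope m 0 < 1\<close>.
\<close>

lemma positive_split_imp:
  assumes "d \<in> splits a m" "0 < d" "a > 0"
  shows "m\<^sup>2 > 1 + 2 * a"
proof -
  have m: "m > 1" using assms by (auto simp: splits_def)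
  obtain x where x: "0 < x" "x < d" "2 * a * gap_slope m (x\<^sup>2) = 1"
    using gap_Rolle[of 0 d m a] assms by (auto simp: splits_def)
  have "x\<^sup>2 < (m - 1)\<^sup>2"
    using x assms by (auto intro!: power_strict_mono simp: splits_def)
  then have "gap_slope m 0 < gap_slope m (x\<^sup>2)"
    using m x by (intro gap_slope_strict_mono) auto
  then have "2 * a * gap_slope m 0 < 1"
    using assms(3) x(3) by (metis mult_strict_left_mono mult_pos_pos zero_less_numeral)
  moreover have "m\<^sup>2 - 1 > 0" using m by simp
  ultimately show ?thesis
    by (simp add: gap_slope_0[OF m] field_simps)
qed

text \<open>
  The gap starts at \<open>0\<close> with a negative slope, and it becomes positive near \<open>d = m - 1\<close>, where
  \<open>level a (m - d)\<close> tends to minus infinity; the intermediate value theorem gives a zero.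
\<close>

lemma positive_split_exists:
  assumes m: "m > 1" and a: "a > 0" and "m\<^sup>2 > 1 + 2 * a"
  obtains d where "d \<in> splits a m" "0 < d"
proof -
  let ?H = "\<lambda>d. level a (m + d) - level a (m - d)"
  have "2 * a * gap_slope m 0 < 1"
    using assms by (simp add: gap_slope_0[OF m] field_simps)
  then have "2 * m / (m\<^sup>2 - 0\<^sup>2) * (2 * a * gap_slope m (0\<^sup>2) - 1) < 0"
    using m by (intro mult_pos_neg) auto
  moreover have "(?H has_real_derivative 2 * m / (m\<^sup>2 - 0\<^sup>2) * (2 * a * gap_slope m (0\<^sup>2) - 1)) (at 0)"
    using m by (intro gap_has_derivative) auto
  ultimately obtain \<delta> where \<delta>: "\<delta> > 0" "\<And>h. 0 < h \<Longrightarrow> h < \<delta> \<Longrightarrow> ?H (0 + h) < ?H 0"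
    using DERIV_neg_dec_right by blast
  \<comment> \<open>The distance from \<open>m - 1\<close> at which the term \<open>a * ln \<epsilon>\<close> of \<open>level a (1 + \<epsilon>)\<close> beats the bounds of
    the other logarithms; the factor \<open>1 / 2\<close> leaves the positive margin \<open>a * ln 2\<close>.\<close>
  define \<epsilon> where "\<epsilon> = (m - 1) * (2 * m) powr (- ((1 + 2 * a) / a)) / 2"
  have "(2 * m) powr (- ((1 + 2 * a) / a)) < (2 * m) powr 0"
    using m a by (intro powr_less_mono) (auto simp: divide_pos_pos)
  then have "(m - 1) * ((2 * m) powr (- ((1 + 2 * a) / a)) / 2) < (m - 1) * 1"
    using m by (intro mult_strict_left_mono) auto
  then have "\<epsilon> < m - 1"
    by (simp only: \<epsilon>_def mult_1_right times_divide_eq_right)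
  moreover have "0 < \<epsilon>"
    using m by (simp add: \<epsilon>_def)
  ultimately have \<epsilon>: "0 < \<epsilon>" "\<epsilon> < m - 1"
    by simp_all
  have ln\<epsilon>: "a * ln \<epsilon> = a * ln (m - 1) - (1 + 2 * a) * ln (2 * m) - a * ln 2"
  proof -
    have "ln \<epsilon> = ln (m - 1) - (1 + 2 * a) / a * ln (2 * m) - ln 2"
      using m by (simp add: \<epsilon>_def ln_div ln_mult ln_powr)
    then show ?thesis
      using a by (simp add: field_simps)
  qed
  define e where "e = m - 1 - \<epsilon>"
  have "?H e > 0"
  proof -
    have "level a (m - e) \<le> a * ln \<epsilon> + a * ln (m + 1)"
    proof -
      have "ln (2 + \<epsilon>) \<le> ln (m + 1)" "0 \<le> ln (1 + \<epsilon>)"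
        using \<epsilon> by auto
      then have "a * ln (2 + \<epsilon>) \<le> a * ln (m + 1)" "0 \<le> (1 + 2 * a) * ln (1 + \<epsilon>)"
        using a by auto
      moreover have "m - e - 1 = \<epsilon>" "m - e + 1 = 2 + \<epsilon>" "m - e = 1 + \<epsilon>"
        by (auto simp: e_def)
      ultimately show ?thesis unfolding level_def by simp
    qed
    moreover have "level a (m + e) \<ge> a * ln (m - 1) + a * ln (m + 1) - (1 + 2 * a) * ln (2 * m)"
    proof -
      have "ln (m - 1) \<le> ln (m + e - 1)" "ln (m + 1) \<le> ln (m + e + 1)" "ln (m + e) \<le> ln (2 * m)"
        using \<epsilon> m by (auto simp: e_def)
      then have "a * ln (m - 1) \<le> a * ln (m + e - 1)" "a * ln (m + 1) \<le> a * ln (m + e + 1)"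
        "(1 + 2 * a) * ln (m + e) \<le> (1 + 2 * a) * ln (2 * m)"
        using a by auto
      then show ?thesis unfolding level_def by linarith
    qed
    moreover have "a * ln 2 > 0" using a by simp
    ultimately show ?thesis using ln\<epsilon> by linarith
  qed
  have "e > 0" "e < m - 1" using \<epsilon> by (auto simp: e_def)
  define h where "h = min (\<delta> / 2) (e / 2)"
  have h: "0 < h" "h < \<delta>" "h < e"
    using \<delta>(1) \<open>e > 0\<close> by (auto simp: h_def)
  have "\<exists>x. h \<le> x \<and> x \<le> e \<and> ?H x = 0"
  proof (rule IVT)
    show "?H h \<le> 0" using \<delta>(2)[OF h(1,2)] by simp
    show "\<forall>x. h \<le> x \<and> x \<le> e \<longrightarrow> isCont ?H x"
      using h \<open>e < m - 1\<close> by (auto intro!: DERIV_isCont[OF gap_has_derivative])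
  qed (use \<open>?H e > 0\<close> h in auto)
  then obtain x where "h \<le> x" "x \<le> e" "?H x = 0" by blast
  then show ?thesis
    using that[of x] h \<open>e < m - 1\<close> by (auto simp: splits_def)
qed

lemma uminus_in_splits_iff: "- d \<in> splits a m \<longleftrightarrow> d \<in> splits a m"
  by (auto simp: splits_def)

lemma splits_empty: "m \<le> 1 \<Longrightarrow> splits a m = {}"
  by (auto simp: splits_def)

lemma splits_trivial:
  assumes "a > 0" "m > 1" "m\<^sup>2 \<le> 1 + 2 * a"
  shows "splits a m = {0}"
proof -
  have "d = 0" if "d \<in> splits a m" for d
    using positive_split_imp[OF that] positive_split_imp[of "- d" a m] that assms
    by (force simp: uminus_in_splits_iff)
  then show ?thesis using assms by (auto simp: splits_def)
qed

lemma splits_three: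
  assumes "a > 0" "m > 1" "m\<^sup>2 > 1 + 2 * a"
  obtains d where "d > 0" "splits a m = {0, d, - d}"
proof -
  obtain d where d: "d \<in> splits a m" "d > 0"
    using positive_split_exists[OF assms(2,1,3)] by blast
  have "e \<in> {0, d, - d}" if "e \<in> splits a m" for e
    using positive_split_unique[OF d(1) that d(2)] positive_split_unique[OF d(1) _ d(2), of "- e"] that
    by (force simp: uminus_in_splits_iff)
  moreover have "0 \<in> splits a m" using assms by (auto simp: splits_def)
  ultimately have "splits a m = {0, d, - d}"
    using d uminus_in_splits_iff by auto
  then show ?thesis using d that by blast
qed

section \<open>Solutions and splits\<close>

lemma tanh_artanh_real:
  fixes t :: real
  assumes "\<bar>t\<bar> < 1"
  shows "tanh (artanh t) = t"
proof -
  have exp_artanh: "exp (- 2 * artanh t) = (1 - t) / (1 + t)"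
    using assms by (simp add: artanh_def exp_minus)
  show ?thesis
    unfolding tanh_real_altdef exp_artanh using assms by (simp add: field_simps)
qed

lemma one_minus_inverse_squared_pos: "1 - (inverse s)\<^sup>2 > 0" if "s > 1" for s :: real
  using that by (simp add: power_inverse inverse_less_1_iff one_less_power)

lemma ln_eq_level:
  assumes "s > 1"
  shows "ln (inverse s * (1 - (inverse s)\<^sup>2) powr a) = level a s"
proof -
  have "1 - (inverse s)\<^sup>2 = (s - 1) * (s + 1) / (s * s)"
    using assms by (simp add: field_simps power2_eq_square)
  then have ln_diff: "ln (1 - (inverse s)\<^sup>2) = ln (s - 1) + ln (s + 1) - 2 * ln s"
    using assms by (simp add: ln_mult ln_div)
  have "ln (inverse s * (1 - (inverse s)\<^sup>2) powr a) = a * ln (1 - (inverse s)\<^sup>2) - ln s"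
    using assms one_minus_inverse_squared_pos[OF assms] by (simp add: ln_mult ln_powr ln_inverse)
  then show ?thesis
    unfolding ln_diff by (simp add: level_def algebra_simps)
qed

lemma tanh_system_iff_level:
  assumes "sp > 1" "sm > 1"
  shows "tanh_system \<beta> p \<omega> (inverse sp) (inverse sm) \<longleftrightarrow>
    level (1 / (p - 2)) sm = level (1 / (p - 2)) sp \<and> sp + sm = \<beta> * sqrt \<omega>"
proof -
  have pos: "inverse s * (1 - (inverse s)\<^sup>2) powr a > 0" if "s > 1" for s a :: real
    using that one_minus_inverse_squared_pos[OF that] by simp
  show ?thesis
    unfolding tanh_system_def ln_eq_level[OF assms(1), symmetric] ln_eq_level[OF assms(2), symmetric]
    using ln_inj_iff[OF pos[OF assms(1)] pos[OF assms(2)], of "1 / (p - 2)" "1 / (p - 2)"] by auto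
qed

context
  fixes \<beta> p \<omega> :: real
  assumes \<beta>: "\<beta> > 0" and p: "p > 2" and \<omega>: "\<omega> > 0"
begin

text \<open>
  The shift \<open>x\<close> at which \<open>tanh (k x)\<close> equals \<open>1 / s\<close>.
\<close>

definition centre :: "real \<Rightarrow> real" where
  "centre s = artanh (inverse s) / cosh_rate p \<omega>"

lemma tanh_centre:
  assumes "s > 1"
  shows "tanh (cosh_rate p \<omega> * centre s) = inverse s" "centre s > 0"
proof -
  have k: "cosh_rate p \<omega> > 0" using p \<omega> by simp
  have "cosh_rate p \<omega> * centre s = artanh (inverse s)"
    using p \<omega> by (simp add: centre_def)
  then show *: "tanh (cosh_rate p \<omega> * centre s) = inverse s"
    using assms tanh_artanh_real[of "inverse s"] by (simp only:) (simp add: inverse_less_1_iff)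
  have "tanh (cosh_rate p \<omega> * centre s) > 0"
    unfolding * using assms by simp
  then have "cosh_rate p \<omega> * centre s > 0"
    by (simp only: tanh_real_pos_iff)
  then show "centre s > 0"
    using k by (rule zero_less_mult_pos)
qed

lemma centre_surj:
  assumes "x > 0"
  obtains s where "s > 1" "centre s = x"
proof
  have k: "cosh_rate p \<omega> > 0" using p \<omega> by simp
  let ?t = "tanh (cosh_rate p \<omega> * x)"
  have t: "0 < ?t" "?t < 1"
    using k assms tanh_real_lt_1 by (simp_all only: tanh_real_pos_iff mult_pos_pos)
  then show "inverse ?t > 1"
    by (simp only: one_less_inverse)
  show "centre (inverse ?t) = x"
    using p \<omega> unfolding centre_def inverse_inverse_eq artanh_tanh_real by simp
qed

lemma centre_inject: "s > 1 \<Longrightarrow> s' > 1 \<Longrightarrow> centre s = centre s' \<longleftrightarrow> s = s'"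
  by (metis tanh_centre(1) inverse_eq_iff_eq)

definition split_solution :: "real \<Rightarrow> real \<Rightarrow> real" where
  "split_solution d = glued_solitons p \<omega> (centre (\<beta> * sqrt \<omega> / 2 - d)) (centre (\<beta> * sqrt \<omega> / 2 + d))"

text \<open>
  The inverses of the two tangents exceed 1 and have the sum \<open>\<beta> * sqrt \<omega>\<close>, so they are the mean
  \<open>\<beta> * sqrt \<omega> / 2\<close> minus and plus some \<open>d\<close>.
\<close>

lemma neg_pos_solutions_eq_image:
  "neg_pos_solutions \<beta> p \<omega> = split_solution ` splits (1 / (p - 2)) (\<beta> * sqrt \<omega> / 2)"
    (is "?N = split_solution ` splits ?a ?m")
proof (intro equalityI subsetI)
  fix u assume "u \<in> ?N"
  then obtain xp xm where u: "u = glued_solitons p \<omega> xp xm" and "xp > 0" "xm > 0"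
    and sys: "tanh_system \<beta> p \<omega> (tanh (cosh_rate p \<omega> * xp)) (tanh (cosh_rate p \<omega> * xm))"
    unfolding neg_pos_solutions_eq[OF \<beta> p \<omega>] by blast
  obtain sp sm where s: "sp > 1" "centre sp = xp" "sm > 1" "centre sm = xm"
    using centre_surj[OF \<open>xp > 0\<close>] centre_surj[OF \<open>xm > 0\<close>] by metis
  have "tanh_system \<beta> p \<omega> (inverse sp) (inverse sm)"
    using sys s tanh_centre(1) by metis
  then have eq: "level ?a sm = level ?a sp" "sp + sm = \<beta> * sqrt \<omega>"
    using tanh_system_iff_level[OF s(1,3)] by auto
  define d where "d = ?m - sp"
  have md: "?m - d = sp" "?m + d = sm"
    using eq(2) by (auto simp: d_def field_simps)
  have "u = split_solution d"
    by (simp only: split_solution_def md u s)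
  moreover have "\<bar>d\<bar> < ?m - 1"
    using md s(1,3) by linarith
  then have "d \<in> splits ?a ?m"
    by (simp only: splits_def mem_Collect_eq md eq simp_thms)
  ultimately show "u \<in> split_solution ` splits ?a ?m" by blast
next
  fix u assume "u \<in> split_solution ` splits ?a ?m"
  then obtain d where d: "d \<in> splits ?a ?m" "u = split_solution d" by blast
  then have s: "?m - d > 1" "?m + d > 1" "level ?a (?m + d) = level ?a (?m - d)"
    by (auto simp: splits_def)
  have "tanh_system \<beta> p \<omega> (inverse (?m - d)) (inverse (?m + d))"
    using tanh_system_iff_level[OF s(1,2)] s(3) by simp
  then show "u \<in> ?N"
    unfolding neg_pos_solutions_eq[OF \<beta> p \<omega>] d(2) split_solution_def
    using tanh_centre[OF s(1)] tanh_centre[OF s(2)] by force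
qed

lemma split_solution_inj: "inj_on split_solution (splits a (\<beta> * sqrt \<omega> / 2))"
proof (rule inj_onI)
  fix d e assume d: "d \<in> splits a (\<beta> * sqrt \<omega> / 2)" and e: "e \<in> splits a (\<beta> * sqrt \<omega> / 2)"
    and "split_solution d = split_solution e"
  moreover have "\<beta> * sqrt \<omega> / 2 - x > 1" "\<beta> * sqrt \<omega> / 2 + x > 1" if "x \<in> splits a (\<beta> * sqrt \<omega> / 2)" for x
    using that by (auto simp: splits_def)
  ultimately have "centre (\<beta> * sqrt \<omega> / 2 - d) = centre (\<beta> * sqrt \<omega> / 2 - e)"
    unfolding split_solution_def using glued_solitons_inject[OF p \<omega>] tanh_centre(2) by blast
  then have "\<beta> * sqrt \<omega> / 2 - d = \<beta> * sqrt \<omega> / 2 - e"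
    using centre_inject d e by (auto simp: splits_def)
  then show "d = e" by simp
qed

lemma odd_split_solution_iff:
  assumes "d \<in> splits a (\<beta> * sqrt \<omega> / 2)"
  shows "odd_function (split_solution d) \<longleftrightarrow> d = 0"
proof -
  have s: "\<beta> * sqrt \<omega> / 2 - d > 1" "\<beta> * sqrt \<omega> / 2 + d > 1"
    using assms by (auto simp: splits_def)
  show ?thesis
    unfolding split_solution_def odd_glued_solitons_iff[OF p \<omega> tanh_centre(2)[OF s(1)] tanh_centre(2)[OF s(2)]]
      centre_inject[OF s] by auto
qed

end

theorem lemma3p3:
  fixes \<beta> p \<omega> :: real
  assumes "\<beta> > 0" and "p > 2" and "\<omega> > 0"
  shows "(\<forall>u \<in> neg_pos_solutions \<beta> p \<omega>.
            \<exists>xp xm tp tm. xp > 0 \<and> xm > 0 \<and>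
              tp = tanh ((p - 2) / 2 * sqrt \<omega> * xp) \<and>
              tm = tanh ((p - 2) / 2 * sqrt \<omega> * xm) \<and>
              (\<forall>x>0. u x = soliton p \<omega> (x - xp)) \<and>
              (\<forall>x<0. u x = - soliton p \<omega> (x + xm)) \<and>
              tp * (1 - tp\<^sup>2) powr (1 / (p - 2)) = tm * (1 - tm\<^sup>2) powr (1 / (p - 2)) \<and>
              inverse tp + inverse tm = \<beta> * sqrt \<omega>)
       \<and> (\<omega> \<le> 4 / \<beta>\<^sup>2 \<longrightarrow> neg_pos_solutions \<beta> p \<omega> = {})
       \<and> (4 / \<beta>\<^sup>2 < \<omega> \<and> \<omega> \<le> p / (p - 2) * (4 / \<beta>\<^sup>2) \<longrightarrow>
            (\<exists>u. neg_pos_solutions \<beta> p \<omega> = {u} \<and> odd_function u))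
       \<and> (p / (p - 2) * (4 / \<beta>\<^sup>2) < \<omega> \<longrightarrow>
            card {u \<in> neg_pos_solutions \<beta> p \<omega>. odd_function u} = 1 \<and>
            card {u \<in> neg_pos_solutions \<beta> p \<omega>. \<not> odd_function u} = 2)"
proof -
  define a m where "a = 1 / (p - 2)" and "m = \<beta> * sqrt \<omega> / 2"
  define sol where "sol = split_solution \<beta> p \<omega>"
  have a: "a > 0" and pa: "1 + 2 * a = p / (p - 2)"
    using assms by (simp_all add: a_def field_simps)
  have m: "m > 0" and m2: "m\<^sup>2 = \<beta>\<^sup>2 * \<omega> / 4"
    using assms by (simp_all add: m_def power_mult_distrib power_divide)
  \<comment> \<open>Both thresholds for \<open>\<omega>\<close> are bounds on \<open>m\<^sup>2\<close>: \<open>c = 1\<close> and \<open>c = p / (p - 2) = 1 + 2 * a\<close>.\<close>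
  have thresh: "\<omega> \<le> c * (4 / \<beta>\<^sup>2) \<longleftrightarrow> m\<^sup>2 \<le> c" for c
    using assms(1) unfolding m2 by (simp add: field_simps)
  have thresh1: "\<omega> \<le> 4 / \<beta>\<^sup>2 \<longleftrightarrow> m \<le> 1"
    using thresh[of 1] m abs_square_le_1[of m] by simp
  have N: "neg_pos_solutions \<beta> p \<omega> = sol ` splits a m"
    unfolding sol_def a_def m_def by (rule neg_pos_solutions_eq_image[OF assms])
  have inj: "inj_on sol (splits a m)"
    unfolding sol_def a_def m_def by (rule split_solution_inj[OF assms])
  have odd: "odd_function (sol d) \<longleftrightarrow> d = 0" if "d \<in> splits a m" for d
    using that unfolding sol_def m_def by (rule odd_split_solution_iff[OF assms])
  show ?thesis
  proof (intro conjI impI ballI)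
    fix u assume "u \<in> neg_pos_solutions \<beta> p \<omega>"
    then obtain xp xm where "u = glued_solitons p \<omega> xp xm" "xp > 0" "xm > 0"
      "tanh_system \<beta> p \<omega> (tanh (cosh_rate p \<omega> * xp)) (tanh (cosh_rate p \<omega> * xm))"
      unfolding neg_pos_solutions_eq[OF assms] by blast
    then show "\<exists>xp xm tp tm. xp > 0 \<and> xm > 0 \<and>
              tp = tanh ((p - 2) / 2 * sqrt \<omega> * xp) \<and>
              tm = tanh ((p - 2) / 2 * sqrt \<omega> * xm) \<and>
              (\<forall>x>0. u x = soliton p \<omega> (x - xp)) \<and>
              (\<forall>x<0. u x = - soliton p \<omega> (x + xm)) \<and>
              tp * (1 - tp\<^sup>2) powr (1 / (p - 2)) = tm * (1 - tm\<^sup>2) powr (1 / (p - 2)) \<and>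
              inverse tp + inverse tm = \<beta> * sqrt \<omega>"
      unfolding tanh_system_def by - (rule exI[of _ xp], rule exI[of _ xm], rule exI[of _ "tanh (cosh_rate p \<omega> * xp)"],
            rule exI[of _ "tanh (cosh_rate p \<omega> * xm)"], simp)
  next
    assume "\<omega> \<le> 4 / \<beta>\<^sup>2"
    then show "neg_pos_solutions \<beta> p \<omega> = {}"
      unfolding N thresh1 by (simp add: splits_empty)
  next
    assume "4 / \<beta>\<^sup>2 < \<omega> \<and> \<omega> \<le> p / (p - 2) * (4 / \<beta>\<^sup>2)"
    then have "splits a m = {0}"
      using thresh1 thresh[of "1 + 2 * a"] unfolding pa[symmetric] by (intro splits_trivial[OF a]) auto
    then have "neg_pos_solutions \<beta> p \<omega> = {sol 0} \<and> odd_function (sol 0)"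
      unfolding N using odd[of 0] by simp
    then show "\<exists>u. neg_pos_solutions \<beta> p \<omega> = {u} \<and> odd_function u" by blast
  next
    assume "p / (p - 2) * (4 / \<beta>\<^sup>2) < \<omega>"
    then have m2a: "m\<^sup>2 > 1 + 2 * a"
      using thresh[of "1 + 2 * a"] unfolding pa[symmetric] by auto
    have "m > 1"
    proof (rule ccontr)
      assume "\<not> m > 1"
      then have "m\<^sup>2 \<le> 1" using m by (simp add: power_le_one)
      then show False using m2a a by simp
    qed
    then obtain d where d: "d > 0" "splits a m = {0, d, - d}"
      using splits_three[OF a _ m2a] by blast
    have three: "neg_pos_solutions \<beta> p \<omega> = {sol 0, sol d, sol (- d)}"
      unfolding N d(2) by simp
    have odd_0: "odd_function (sol 0)" and not_odd: "\<not> odd_function (sol d)" "\<not> odd_function (sol (- d))"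
      using odd[unfolded d(2)] d(1) by simp_all
    have "{u \<in> neg_pos_solutions \<beta> p \<omega>. odd_function u} = {sol 0}"
      unfolding three using odd_0 not_odd by blast
    then show "card {u \<in> neg_pos_solutions \<beta> p \<omega>. odd_function u} = 1"
      by simp
    have "{u \<in> neg_pos_solutions \<beta> p \<omega>. \<not> odd_function u} = {sol d, sol (- d)}"
      unfolding three using odd_0 not_odd by blast
    moreover have "sol d \<noteq> sol (- d)"
      using inj_onD[OF inj, of d "- d"] d by auto
    ultimately show "card {u \<in> neg_pos_solutions \<beta> p \<omega>. \<not> odd_function u} = 2"
      by simp
  qed
qed

end
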